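(* Let $f(X,Y)\in \mathbb{Q}[X,Y]$ be irreducible. Then there exist infinitely many rational numbers $b$ such that $f_b(Y)=f(b,Y)$ is irreducible in $\mathbb{Q}[Y]$.
   Context: Convention: for a field $F$, a polynomial $f\in F[X,Y]$ is called irreducible if it is an irreducible element of the ring $F[X][Y]$ and has degree greater than $0$ in $Y$. *)

theory Defs
  imports "HOL-Computational_Algebra.Computational_Algebra"
begin

text \<open>
  A polynomial in \<open>F[X,Y]\<close> is an element of \<open>F[X][Y]\<close>, i.e. of type \<open>'a poly poly\<close>: the outer
  variable is \<open>Y\<close>, the coefficients are polynomials in \<open>X\<close>, and \<open>degree\<close> is the degree in \<open>Y\<close>.
\<close>

definition irreducible_XY :: "'a :: field poly poly \<Rightarrow> bool" where
  "irreducible_XY f \<longleftrightarrow> irreducible f \<and> degree f > 0"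

text \<open>The specialization \<open>f(b,Y)\<close>: only the inner variable \<open>X\<close> is evaluated.\<close>

definition specialize_X :: "'a :: comm_semiring_0 poly poly \<Rightarrow> 'a \<Rightarrow> 'a poly" where
  "specialize_X f b = map_poly (\<lambda>c. poly c b) f"

end

theory Submission
  imports Defs "HOL-Computational_Algebra.Field_as_Ring" "HOL-Library.Landau_Symbols"
begin

text \<open>
  Choose \<open>b\<close> such that \<open>f(b,Y)\<close> has full degree and is squarefree. By Hensel's lemma the roots of
  \<open>f(b + t, Y)\<close> are power series in \<open>t\<close>, and they are the asymptotic expansions, in powers of \<open>1/s\<close>,
  of the complex roots of \<open>f(b + 1/s, Y)\<close> as the natural number \<open>s\<close> tends to infinity.
  If \<open>f(b + 1/s, Y)\<close> is reducible, then for some proper nonempty set \<open>S\<close> of roots the coefficients of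
  \<open>\<Prod>\<alpha>\<in>S. (Y - r\<^sub>\<alpha>(s))\<close>, scaled by an integral multiple of the leading coefficient, are integers.
  Irreducibility of \<open>f\<close> implies that for at least one of these coefficients the expansion is not a
  polynomial in \<open>s\<close> over the rationals. Subtract the rational leading terms and clear denominators:
  either a divided difference of the rest converges to an irrational number, although it is integral
  wherever all its nodes give integral values, or the rest converges to 0 without
  vanishing. So any finite pattern of more than \<open>m\<close> nodes occurs only finitely often among the \<open>s\<close> with
  integral values. Sets with this property are closed under finite unions, while the set of all natural
  numbers does not have it.
\<close>

section \<open>Bezout identity, Gauss lemma and Hensel lemma\<close>

text \<open>Evaluation at a point, the constant term of a power series, Taylor expansion and the
  inclusions of the integers and rationals are all applied coefficientwise to polynomials. One
  locale transports sums, products, derivatives and values for all of them.\<close>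

locale ring_map =
  fixes h :: "'a :: idom \<Rightarrow> 'b :: idom"
  assumes map_one: "h 1 = 1"
    and map_add: "h (x + y) = h x + h y"
    and map_mult: "h (x * y) = h x * h y"
begin

lemma map_zero [simp]: "h 0 = 0"
  using map_add[of 0 0] by (simp only: add_0_right add_cancel_right_right)

lemma map_sum: "h (sum g A) = (\<Sum>x\<in>A. h (g x))"
  by (induction A rule: infinite_finite_induct) (auto simp: map_add)

lemma map_of_nat: "h (of_nat n) = of_nat n"
  by (induction n) (auto simp: map_add map_one)

lemma map_poly_add: "map_poly h (p + q) = map_poly h p + map_poly h q"
  by (intro poly_eqI) (simp add: coeff_map_poly map_add)

lemma map_poly_mult: "map_poly h (p * q) = map_poly h p * map_poly h q"
  by (intro poly_eqI) (simp add: coeff_map_poly coeff_mult map_sum map_mult)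

lemma poly_map_poly: "poly (map_poly h p) (h x) = h (poly p x)"
  by (induction p) (auto simp: map_poly_pCons map_add map_mult)

lemma map_poly_pderiv: "map_poly h (pderiv p) = pderiv (map_poly h p)"
  by (intro poly_eqI) (simp add: coeff_map_poly coeff_pderiv map_mult map_of_nat map_add map_one)

end

lemma ring_map_of_rat: "ring_map (of_rat :: rat \<Rightarrow> 'a :: field_char_0)"
  by unfold_locales (auto simp: of_rat_add of_rat_mult)

lemma ring_map_of_int: "ring_map (of_int :: int \<Rightarrow> 'a :: idom)"
  by unfold_locales auto

lemma ring_map_poly: "ring_map (\<lambda>p. poly p b)"
  by unfold_locales auto

lemma ring_map_fps_nth_0: "ring_map (\<lambda>a :: 'a :: idom fps. a $ 0)"
  by unfold_locales auto

lemma ring_map_comp: "ring_map g \<Longrightarrow> ring_map h \<Longrightarrow> ring_map (\<lambda>x. g (h x))"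
  by (simp add: ring_map_def)

text \<open>A nonzero element of least degree in the ideal generated by \<open>f\<close> and \<open>h\<close> divides a multiple
  \<open>smult c f\<close> with \<open>c\<close> free of \<open>Y\<close>; primality of \<open>f\<close> forces it to have degree 0.\<close>

lemma irreducible_bezout:
  fixes f h :: "rat poly poly"
  assumes f: "irreducible f" and h: "h \<noteq> 0" "degree h < degree f"
  obtains A B R where "R \<noteq> 0" "A * f + B * h = [:R:]"
proof -
  define I where "I = {A * f + B * h |A B. True} - {0}"
  have "h = 0 * f + 1 * h" by simp
  hence "\<exists>A B. h = A * f + B * h" by (intro exI)
  with h have "h \<in> I" unfolding I_def by simp
  then obtain g where g: "g \<in> I" and min: "\<And>g'. g' \<in> I \<Longrightarrow> degree g \<le> degree g'"
    using ex_has_least_nat[of "\<lambda>g. g \<in> I" h degree] by blast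
  obtain A B where gAB: "g = A * f + B * h" and g0: "g \<noteq> 0" using g by (auto simp: I_def)
  obtain q r where qr: "pseudo_divmod f g = (q, r)" by force
  from pseudo_divmod[OF g0 qr] obtain k where
    k: "smult (coeff g (degree g) ^ k) f = g * q + r" and r: "r = 0 \<or> degree r < degree g" by blast
  define c where "c = coeff g (degree g) ^ k"
  have c0: "c \<noteq> 0" using g0 by (simp add: c_def)
  have "r = 0"
  proof (rule ccontr)
    assume "r \<noteq> 0"
    have "r = ([:c:] - q * A) * f + (- q * B) * h"
    proof -
      have "r = [:c:] * f - g * q" using k by (simp add: c_def)
      thus ?thesis unfolding gAB by (simp add: algebra_simps)
    qed
    hence "r \<in> I" using \<open>r \<noteq> 0\<close> unfolding I_def by blast
    with min[of r] r \<open>r \<noteq> 0\<close> show False by auto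
  qed
  hence eq: "[:c:] * f = g * q" using k by (simp add: c_def)
  have "prime_elem f" using f by (rule irreducible_imp_prime_elem)
  moreover have "f dvd g * q" by (metis eq dvd_triv_right)
  moreover have "\<not> f dvd g"
  proof
    assume "f dvd g"
    hence "degree f \<le> degree g" using g0 by (rule dvd_imp_degree_le)
    with min[OF \<open>h \<in> I\<close>] h show False by simp
  qed
  ultimately obtain q' where q': "q = f * q'" by (auto simp: prime_elem_dvd_mult_iff)
  have "f \<noteq> 0" using h by auto
  have "f * [:c:] = f * (g * q')" using eq by (simp add: q' algebra_simps)
  hence "[:c:] = g * q'" using \<open>f \<noteq> 0\<close> by (metis mult_left_cancel)
  hence "degree g = 0" using c0
    by (metis add_is_0 degree_mult_eq degree_pCons_0 mult_eq_0_iff pCons_eq_0_iff)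
  then obtain R where "g = [:R:]" by (rule degree_eq_zeroE)
  thus ?thesis using that[of R A B] gAB g0 by auto
qed

section \<open>Gauss's lemma for monic rational divisors\<close>

lemma rat_poly_common_denominator:
  fixes g :: "rat poly"
  obtains c :: int and G where "c \<noteq> 0" "smult (of_int c) g = map_poly of_int G"
proof -
  interpret ring_map "of_int :: int \<Rightarrow> rat" by (rule ring_map_of_int)
  have "\<exists>c::int. \<exists>G. c \<noteq> 0 \<and> smult (of_int c) g = map_poly of_int G"
  proof (induction g)
    case 0
    show ?case by (intro exI[of _ 1] exI[of _ 0]) auto
  next
    case (pCons a g)
    then obtain c :: int and G where c: "c \<noteq> 0" and G: "smult (of_int c) g = map_poly of_int G" by auto
    obtain n d where nd: "quotient_of a = (n, d)" by force
    have d: "d > 0" "a = of_int n / of_int d"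
      using quotient_of_denom_pos[OF nd] quotient_of_div[OF nd] by auto
    have "smult (of_int (c * d)) (pCons a g) = map_poly of_int (pCons (c * n) (smult d G))"
      using d by (simp add: map_poly_pCons map_poly_smult G[symmetric] mult_ac)
    thus ?case using c d by (intro exI[of _ "c * d"]) auto
  qed
  thus ?thesis using that by blast
qed

text \<open>By Gauss's lemma the primitive integral multiple \<open>G1\<close> of \<open>g\<close>
  divides \<open>F\<close> over the integers. Since \<open>g\<close> is monic, \<open>G1\<close> is
  \<open>lead_coeff G1\<close> times \<open>g\<close>, and \<open>lead_coeff G1\<close> divides
  \<open>lead_coeff F\<close>.\<close>

lemma lead_coeff_mult_monic_divisor_integral:
  fixes F :: "int poly" and g :: "rat poly"
  assumes g: "lead_coeff g = 1" "g dvd map_poly of_int F"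
  shows "of_int (lead_coeff F) * coeff g j \<in> \<int>"
proof -
  interpret Z: ring_map "of_int :: int \<Rightarrow> rat" by (rule ring_map_of_int)
  have inj: "P = Q" if "map_poly (of_int :: int \<Rightarrow> rat) P = map_poly of_int Q" for P Q
  proof (rule poly_eqI)
    fix n show "coeff P n = coeff Q n"
      using arg_cong[OF that, of "\<lambda>p. coeff p n"] by (simp add: coeff_map_poly)
  qed
  obtain h where h: "map_poly of_int F = g * h" using g(2) by auto
  obtain c G where c: "c \<noteq> 0" and G: "smult (of_int c) g = map_poly of_int G"
    by (rule rat_poly_common_denominator)
  obtain e H where e: "e \<noteq> 0" and H: "smult (of_int e) h = map_poly of_int H"
    by (rule rat_poly_common_denominator)
  define G1 where "G1 = primitive_part G"
  have "G \<noteq> 0" using G g c by auto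
  hence cont: "content G1 = 1" by (simp add: G1_def)
  have GG: "G = smult (content G) G1" by (simp add: G1_def)
  have "map_poly of_int (smult (c * e) F) = (map_poly of_int (G * H) :: rat poly)"
    by (simp add: map_poly_smult Z.map_poly_mult G[symmetric] H[symmetric] h mult_ac)
  hence "smult (c * e) F = G * H" by (rule inj)
  also have "\<dots> = G1 * smult (content G) H" by (subst GG) simp
  finally have eq: "smult (c * e) F = G1 * smult (content G) H" .
  \<comment> \<open>Contents are multiplicative and \<open>G1\<close> is primitive, so
    \<open>c * e\<close> divides the content of the cofactor and can be cancelled.\<close>
  have "content (smult (c * e) F) = content (smult (content G) H)"
    by (subst eq, subst content_mult) (simp add: cont)
  hence "c * e dvd content (smult (content G) H)" by (metis content_smult dvd_triv_left normalize_dvd_iff dvd_mult2 dvd_refl)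
  hence "[:c * e:] dvd smult (content G) H" by (simp add: const_poly_dvd_iff_dvd_content)
  then obtain H1 where H1: "smult (content G) H = smult (c * e) H1" by (auto elim!: dvdE)
  have "smult (c * e) F = smult (c * e) (G1 * H1)" using eq H1 by simp
  hence F: "F = G1 * H1" using c e by (metis mult_eq_0_iff smult_cancel)
  have cG: "of_int (content G) * (of_int (coeff G1 i) :: rat) = of_int c * coeff g i" for i
    using arg_cong[OF G, of "\<lambda>p. coeff p i"] arg_cong[OF GG, of "\<lambda>p. coeff p i"]
    by (simp add: coeff_map_poly)
  have deg: "degree G1 = degree g"
  proof -
    have "degree (map_poly (of_int :: int \<Rightarrow> rat) G) = degree G"
      by (rule degree_map_poly) auto
    thus ?thesis using c by (simp add: G[symmetric] G1_def)
  qed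
  define l where "l = lead_coeff G1"
  have "of_int (content G) * of_int l = (of_int c :: rat)"
    using cG[of "degree g"] g(1) by (simp add: l_def deg)
  hence "of_int (content G) * (of_int l * coeff g j) = of_int (content G) * (of_int (coeff G1 j) :: rat)"
    using cG[of j] by (simp add: mult_ac)
  hence "of_int l * coeff g j = of_int (coeff G1 j)" using \<open>G \<noteq> 0\<close> by simp
  hence "of_int (lead_coeff F) * coeff g j = of_int (lead_coeff H1 * coeff G1 j)"
    by (simp add: F lead_coeff_mult l_def algebra_simps)
  thus ?thesis by (metis Ints_of_int)
qed

section \<open>Hensel's lemma for formal power series\<close>

lemma poly_add_expand:
  fixes F :: "'a :: idom poly"
  shows "\<exists>r. poly F (y + z) = poly F y + z * poly (pderiv F) y + z ^ 2 * r"
proof (induction F)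
  case 0
  show ?case by simp
next
  case (pCons a F)
  then obtain r where r: "poly F (y + z) = poly F y + z * poly (pderiv F) y + z ^ 2 * r" by blast
  show ?case
    by (rule exI[of _ "poly (pderiv F) y + y * r + z * r"])
       (simp add: r pderiv_pCons power2_eq_square algebra_simps)
qed

lemma poly_fps_cong:
  fixes F :: "'a :: idom fps poly"
  assumes "\<And>k. k < N \<Longrightarrow> y $ k = z $ k" "k < N"
  shows "poly F y $ k = poly F z $ k"
  using assms(2)
proof (induction F arbitrary: k)
  case (pCons a F)
  have "(y * poly F y) $ k = (z * poly F z) $ k"
    unfolding fps_mult_nth using pCons assms(1) by (intro sum.cong) auto
  thus ?case by simp
qed simp

text \<open>Newton's method, one coefficient at a time: at a simple root the derivative has an
  invertible constant term, so the next coefficient of \<open>poly F y\<close> can be cancelled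
  without disturbing the earlier ones.\<close>

lemma fps_hensel:
  fixes F :: "'a :: field fps poly"
  assumes root: "poly (map_poly (\<lambda>a. a $ 0) F) x = 0"
    and simple: "poly (map_poly (\<lambda>a. a $ 0) (pderiv F)) x \<noteq> 0"
  obtains y where "poly F y = 0" "y $ 0 = x"
proof -
  interpret ring_map "\<lambda>a :: 'a fps. a $ 0" by (rule ring_map_fps_nth_0)
  have ev: "poly G y $ 0 = poly (map_poly (\<lambda>a. a $ 0) G) (y $ 0)" for G and y :: "'a fps"
    using poly_map_poly[of G y] by simp
  define P where "P N y \<longleftrightarrow> y $ 0 = x \<and> (\<forall>k\<le>N. poly F y $ k = 0)" for N and y :: "'a fps"
  have "\<exists>Y. \<forall>N. P N (Y N) \<and> (\<forall>k\<le>N. Y (Suc N) $ k = Y N $ k)"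
  proof (rule dependent_nat_choice)
    show "\<exists>y. P 0 y"
      using root by (intro exI[of _ "fps_const x"]) (simp add: P_def ev)
  next
    fix y N assume y: "P N y"
    \<comment> \<open>With this \<open>c\<close> the linear Taylor term cancels coefficient
      \<open>Suc N\<close>; the quadratic term only starts at order
      \<open>2 * Suc N\<close>.\<close>
    define c where "c = - poly F y $ Suc N / poly (pderiv F) y $ 0"
    define z where "z = fps_const c * fps_X ^ Suc N"
    have z: "(z * w) $ k = (if k < Suc N then 0 else c * w $ (k - Suc N))" for w k
      unfolding z_def by (simp add: mult.assoc fps_X_power_mult_nth del: power_Suc)
    have zk: "z $ k = (if k = Suc N then c else 0)" for k
      unfolding z_def by (simp add: fps_X_power_nth del: power_Suc)
    from poly_add_expand[of F y z] obtain r where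
      r: "poly F (y + z) = poly F y + z * poly (pderiv F) y + z ^ 2 * r" ..
    have zz: "(z ^ 2 * r) $ k = 0" if "k \<le> Suc N" for k
      using z[of "z * r" k] z[of r "k - Suc N"] that
      by (simp add: power2_eq_square mult.assoc split: if_splits)
    have "poly (pderiv F) y $ 0 \<noteq> 0" using simple y by (simp add: ev P_def)
    hence c: "c * poly (pderiv F) y $ 0 = - poly F y $ Suc N" by (simp add: c_def)
    have "poly F (y + z) $ k = 0" if "k \<le> Suc N" for k
    proof (cases "k = Suc N")
      case True
      thus ?thesis using c by (simp add: r z zz)
    next
      case False
      thus ?thesis using that y by (simp add: r z zz P_def)
    qed
    hence "P (Suc N) (y + z)" using y by (simp add: P_def zk)
    moreover have "\<forall>k\<le>N. (y + z) $ k = y $ k" by (simp add: zk)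
    ultimately show "\<exists>y'. P (Suc N) y' \<and> (\<forall>k\<le>N. y' $ k = y $ k)"
      by (intro exI[of _ "y + z"] conjI)
  qed
  then obtain Y where "\<forall>N. P N (Y N) \<and> (\<forall>k\<le>N. Y (Suc N) $ k = Y N $ k)" ..
  hence Y: "P N (Y N)" and step: "k \<le> N \<Longrightarrow> Y (Suc N) $ k = Y N $ k" for N k by auto
  \<comment> \<open>Coefficient \<open>k\<close> no longer changes from stage \<open>k\<close> on,
    so the diagonal of the approximations is their limit.\<close>
  have stable: "Y N $ k = Y k $ k" if "k \<le> N" for N k
    using that by (induction N rule: dec_induct) (auto simp: step)
  define y where "y = Abs_fps (\<lambda>k. Y k $ k)"
  have "poly F y $ N = 0" for N
  proof -
    have "poly F y $ N = poly F (Y N) $ N"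
    proof (rule poly_fps_cong)
      show "y $ k = Y N $ k" if "k < Suc N" for k
        using stable[of k N] that by (simp add: y_def)
    qed simp
    also have "\<dots> = 0" using Y[of N] by (simp add: P_def)
    finally show ?thesis .
  qed
  hence "poly F y = 0" by (simp add: fps_eq_iff)
  moreover have "y $ 0 = x" using Y[of 0] by (simp add: y_def P_def)
  ultimately show ?thesis by (rule that)
qed

section \<open>Asymptotic expansions in powers of 1/s\<close>

text \<open>The series \<open>a\<close> is read in the variable \<open>1/s\<close>. Only truncations
  occur, so its convergence is not at issue; a full asymptotic expansion is this statement for every
  \<open>N\<close>.\<close>

definition asym_upto :: "nat \<Rightarrow> (nat \<Rightarrow> complex) \<Rightarrow> complex fps \<Rightarrow> bool" where
  "asym_upto N u a \<longleftrightarrow> (\<lambda>s. u s - (\<Sum>k<N. a $ k / of_nat s ^ k)) \<in> O(\<lambda>s. 1 / of_nat s ^ N)"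

lemma asym_upto_0: "asym_upto 0 u a \<longleftrightarrow> u \<in> O(\<lambda>_. 1)"
  by (simp add: asym_upto_def)

lemma inverse_nat_bigo_1: "(\<lambda>s::nat. 1 / of_nat s :: complex) \<in> O(\<lambda>_. 1)"
  by (rule bigoI[of _ 1]) (auto simp: norm_divide divide_simps intro: eventually_mono[OF eventually_gt_at_top[of 0]])

text \<open>Removing the constant term and multiplying by \<open>s\<close> lowers the order by one;
  inductions on \<open>N\<close> rest on this.\<close>

lemma asym_upto_Suc:
  "asym_upto (Suc N) u a \<longleftrightarrow> asym_upto N (\<lambda>s. (u s - a $ 0) * of_nat s) (fps_shift 1 a)"
proof -
  define D where "D s = u s - (\<Sum>k<Suc N. a $ k / of_nat s ^ k)" for s
  define E where "E s = (u s - a $ 0) * of_nat s - (\<Sum>k<N. fps_shift 1 a $ k / of_nat s ^ k)" for s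
  have ED: "E s = D s * of_nat s" if "s > 0" for s
    unfolding E_def D_def sum.lessThan_Suc_shift using that
    by (simp add: algebra_simps sum_distrib_left sum_distrib_right)
  have ev: "eventually (\<lambda>s::nat. s > 0) sequentially" by (rule eventually_gt_at_top)
  have "D \<in> O(\<lambda>s. 1 / of_nat s ^ Suc N) \<longleftrightarrow> E \<in> O(\<lambda>s. 1 / of_nat s ^ N)"
  proof
    assume "D \<in> O(\<lambda>s. 1 / of_nat s ^ Suc N)"
    hence "(\<lambda>s. D s * of_nat s) \<in> O(\<lambda>s. 1 / of_nat s ^ Suc N * of_nat s)"
      by (rule landau_o.big.mult_right)
    also have "(\<lambda>s. D s * of_nat s) \<in> O(\<lambda>s. 1 / of_nat s ^ Suc N * of_nat s) \<longleftrightarrow> E \<in> O(\<lambda>s. 1 / of_nat s ^ N)"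
      by (intro landau_o.big.cong_ex eventually_mono[OF ev]) (auto simp: ED)
    finally show "E \<in> O(\<lambda>s. 1 / of_nat s ^ N)" .
  next
    assume "E \<in> O(\<lambda>s. 1 / of_nat s ^ N)"
    hence "(\<lambda>s. E s * (1 / of_nat s)) \<in> O(\<lambda>s. 1 / of_nat s ^ N * (1 / of_nat s))"
      by (rule landau_o.big.mult_right)
    also have "(\<lambda>s. E s * (1 / of_nat s)) \<in> O(\<lambda>s. 1 / of_nat s ^ N * (1 / of_nat s)) \<longleftrightarrow>
        D \<in> O(\<lambda>s. 1 / of_nat s ^ Suc N)"
      by (intro landau_o.big.cong_ex eventually_mono[OF ev]) (auto simp: ED)
    finally show "D \<in> O(\<lambda>s. 1 / of_nat s ^ Suc N)" .
  qed
  thus ?thesis unfolding asym_upto_def D_def E_def .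
qed

lemma asym_upto_cong:
  assumes "eventually (\<lambda>s. u s = v s) sequentially" "\<And>k. k < N \<Longrightarrow> a $ k = b $ k"
  shows "asym_upto N u a \<longleftrightarrow> asym_upto N v b"
  unfolding asym_upto_def
  by (rule landau_o.big.in_cong) (use assms in \<open>auto elim!: eventually_mono\<close>)

lemma asym_upto_Suc_imp:
  assumes "asym_upto (Suc N) u a"
  shows "asym_upto N u a"
proof -
  have "(\<lambda>s. 1 / of_nat s ^ Suc N :: complex) \<in> O(\<lambda>s. 1 / of_nat s ^ N)"
  proof -
    have "(\<lambda>s. 1 / of_nat s ^ N * (1 / of_nat s) :: complex) \<in> O(\<lambda>s. 1 / of_nat s ^ N * 1)"
      by (intro landau_o.big.mult landau_o.big_refl inverse_nat_bigo_1)
    thus ?thesis by (simp add: mult.commute)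
  qed
  hence "(\<lambda>s. u s - (\<Sum>k<Suc N. a $ k / of_nat s ^ k)) \<in> O(\<lambda>s. 1 / of_nat s ^ N)"
    using assms landau_o.big.trans unfolding asym_upto_def by blast
  moreover have "(\<lambda>s. a $ N * (1 / of_nat s ^ N)) \<in> O(\<lambda>s. 1 / of_nat s ^ N)"
    by (simp del: times_divide_eq_right)
  ultimately have "(\<lambda>s. (u s - (\<Sum>k<Suc N. a $ k / of_nat s ^ k)) + a $ N * (1 / of_nat s ^ N)) \<in> O(\<lambda>s. 1 / of_nat s ^ N)"
    by (rule sum_in_bigo)
  thus ?thesis by (simp add: asym_upto_def)
qed

lemma asym_upto_antimono: "asym_upto N u a \<Longrightarrow> M \<le> N \<Longrightarrow> asym_upto M u a"
  by (induction N) (auto simp: le_Suc_eq dest: asym_upto_Suc_imp)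

lemma asym_upto_add:
  assumes "asym_upto N u a" "asym_upto N v b"
  shows "asym_upto N (\<lambda>s. u s + v s) (a + b)"
  using sum_in_bigo(1)[OF assms[unfolded asym_upto_def]]
  by (simp add: asym_upto_def sum.distrib add_divide_distrib algebra_simps)

lemma asym_upto_cmult:
  assumes "asym_upto N u a"
  shows "asym_upto N (\<lambda>s. c * u s) (fps_const c * a)"
proof -
  have "(\<lambda>s. c * (u s - (\<Sum>k<N. a $ k / of_nat s ^ k))) \<in> O(\<lambda>s. 1 / of_nat s ^ N)"
    using assms unfolding asym_upto_def by simp
  thus ?thesis by (simp add: asym_upto_def algebra_simps sum_distrib_left)
qed

text \<open>The induction uses s(uv - a0 b0) = a0 s(v - b0) + s(u - a0) v, whose right-hand side
  involves only expansions of order \<open>N\<close>; the formal series obey the same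
  identity.\<close>

lemma asym_upto_mult:
  assumes "asym_upto N u a" "asym_upto N v b"
  shows "asym_upto N (\<lambda>s. u s * v s) (a * b)"
  using assms
proof (induction N arbitrary: u v a b)
  case 0
  thus ?case using landau_o.big.mult[of u _ "\<lambda>_. 1" v "\<lambda>_. 1"] by (simp add: asym_upto_0)
next
  case (Suc N)
  let ?u = "\<lambda>s. (u s - a $ 0) * of_nat s" and ?v = "\<lambda>s. (v s - b $ 0) * of_nat s"
  have u: "asym_upto N ?u (fps_shift 1 a)" and v: "asym_upto N ?v (fps_shift 1 b)"
    using Suc.prems by (simp_all add: asym_upto_Suc)
  have "asym_upto N (\<lambda>s. a $ 0 * ?v s + ?u s * v s)
      (fps_const (a $ 0) * fps_shift 1 b + fps_shift 1 a * b)"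
    by (rule asym_upto_add[OF asym_upto_cmult[OF v] Suc.IH[OF u asym_upto_Suc_imp[OF Suc.prems(2)]]])
  moreover have "fps_const (a $ 0) * fps_shift 1 b + fps_shift 1 a * b = fps_shift 1 (a * b)"
  proof (rule fps_ext)
    fix n
    have "(a * b) $ Suc n = a $ 0 * b $ Suc n + (\<Sum>i=0..n. a $ Suc i * b $ (n - i))"
      unfolding fps_mult_nth by (subst sum.atLeast0_atMost_Suc_shift) simp
    thus "(fps_const (a $ 0) * fps_shift 1 b + fps_shift 1 a * b) $ n = fps_shift 1 (a * b) $ n"
      by (simp add: fps_mult_nth[of "fps_shift (Suc 0) a"] del: fps_mult_nth_0)
  qed
  ultimately show ?case by (simp add: asym_upto_Suc algebra_simps)
qed

lemma asym_upto_const: "asym_upto N (\<lambda>_. c) (fps_const c)"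
proof (induction N arbitrary: c)
  case (Suc N)
  have "fps_shift 1 (fps_const c) = 0" by (rule fps_ext) simp
  thus ?case using Suc[of 0] by (simp add: asym_upto_Suc)
qed (simp add: asym_upto_0)

lemma asym_upto_X: "asym_upto N (\<lambda>s. 1 / of_nat s) fps_X"
proof (cases N)
  case 0
  thus ?thesis using inverse_nat_bigo_1 by (simp add: asym_upto_0)
next
  case (Suc M)
  have "asym_upto M (\<lambda>s. 1) (fps_shift 1 fps_X) \<longleftrightarrow> asym_upto N (\<lambda>s. 1 / of_nat s) fps_X"
    unfolding Suc asym_upto_Suc
    by (intro asym_upto_cong eventually_mono[OF eventually_gt_at_top[of 0]]) auto
  moreover have "fps_shift 1 fps_X = (fps_const 1 :: complex fps)" by (rule fps_ext) (auto simp: fps_X_def)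
  ultimately show ?thesis using asym_upto_const[of M 1] by simp
qed

lemma asym_upto_poly: "asym_upto N (\<lambda>s. poly p (1 / of_nat s)) (fps_of_poly p)"
proof (induction p)
  case 0
  show ?case using asym_upto_const[of N 0] by simp
next
  case (pCons c p)
  have "asym_upto N (\<lambda>s. c + 1 / of_nat s * poly p (1 / of_nat s)) (fps_const c + fps_X * fps_of_poly p)"
    by (intro asym_upto_add asym_upto_mult asym_upto_const asym_upto_X pCons.IH)
  thus ?case by (simp add: fps_of_poly_pCons mult.commute)
qed

text \<open>Rescaling isolates the coefficient of order \<open>N\<close>. It yields limits of
  leading terms, and also eventual nonvanishing when that coefficient is not 0.\<close>

lemma asym_upto_limit:
  assumes "asym_upto (Suc N) u a"
  shows "(\<lambda>s. (u s - (\<Sum>k<N. a $ k / of_nat s ^ k)) * of_nat s ^ N) \<longlonglongrightarrow> a $ N"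
proof -
  have "(\<lambda>s. (u s - (\<Sum>k<Suc N. a $ k / of_nat s ^ k)) * of_nat s ^ N) \<in> O(\<lambda>s. 1 / of_nat s ^ Suc N * of_nat s ^ N)"
    using assms unfolding asym_upto_def by (rule landau_o.big.mult_right)
  also have "(\<lambda>s. 1 / of_nat s ^ Suc N * of_nat s ^ N :: complex) \<in> \<Theta>(\<lambda>s. 1 / of_nat s)"
    by (intro bigthetaI_cong eventually_mono[OF eventually_gt_at_top[of 0]]) auto
  also have "(\<lambda>s. 1 / of_nat s :: complex) \<in> o(\<lambda>_. 1)"
    by (rule smalloI_tendsto) (auto intro: lim_1_over_n)
  finally have "(\<lambda>s. (u s - (\<Sum>k<Suc N. a $ k / of_nat s ^ k)) * of_nat s ^ N) \<longlonglongrightarrow> 0"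
    by (auto dest: smalloD_tendsto)
  hence "(\<lambda>s. (u s - (\<Sum>k<Suc N. a $ k / of_nat s ^ k)) * of_nat s ^ N + a $ N) \<longlonglongrightarrow> 0 + a $ N"
    by (intro tendsto_add tendsto_const)
  moreover have "(u s - (\<Sum>k<Suc N. a $ k / of_nat s ^ k)) * of_nat s ^ N + a $ N =
      (u s - (\<Sum>k<N. a $ k / of_nat s ^ k)) * of_nat s ^ N" if "s > 0" for s
    using that by (simp add: algebra_simps)
  ultimately show ?thesis
    by (auto elim!: Lim_transform_eventually intro: eventually_mono[OF eventually_gt_at_top[of 0]])
qed

section \<open>Thin sets of natural numbers\<close>

text \<open>The bound \<open>m\<close> depends on \<open>A\<close> alone, while the pattern
  \<open>D\<close> is arbitrary beyond it. This uniformity is what lets finite unions be handled by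
  pigeonhole.\<close>

definition thin :: "nat set \<Rightarrow> bool" where
  "thin A \<longleftrightarrow> (\<exists>m. \<forall>D. finite D \<longrightarrow> card D > m \<longrightarrow> finite {s. \<forall>d\<in>D. s + d \<in> A})"

lemma thin_subset:
  assumes "thin B" "A \<subseteq> B"
  shows "thin A"
proof -
  obtain m where m: "\<forall>D. finite D \<longrightarrow> card D > m \<longrightarrow> finite {s. \<forall>d\<in>D. s + d \<in> B}"
    using assms(1) unfolding thin_def ..
  have "finite {s. \<forall>d\<in>D. s + d \<in> A}" if "finite D" "card D > m" for D
    by (rule finite_subset[OF _ m[rule_format, OF that]]) (use assms(2) in auto)
  thus ?thesis unfolding thin_def by blast
qed

lemma thin_finite:
  assumes "finite A"
  shows "thin A"
  unfolding thin_def
proof (intro exI[of _ 0] allI impI)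
  fix D :: "nat set" assume "finite D" "card D > 0"
  then obtain d where "d \<in> D" by fastforce
  have "finite ((\<lambda>s. s + d) -` A)" using assms by (intro finite_vimageI) (auto simp: inj_on_def)
  thus "finite {s. \<forall>d\<in>D. s + d \<in> A}" by (rule rev_finite_subset) (use \<open>d \<in> D\<close> in auto)
qed

text \<open>If a pattern with more than \<open>m + n\<close> nodes lands in the union, then more
  than \<open>m\<close> nodes land in \<open>A\<close> or more than \<open>n\<close> in
  \<open>B\<close>. There are finitely many such subpatterns, each realized by finitely many
  \<open>s\<close>.\<close>

lemma thin_Un:
  assumes "thin A" "thin B"
  shows "thin (A \<union> B)"
proof -
  obtain m where m: "\<forall>D. finite D \<longrightarrow> card D > m \<longrightarrow> finite {s. \<forall>d\<in>D. s + d \<in> A}"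
    using assms(1) unfolding thin_def ..
  obtain n where n: "\<forall>D. finite D \<longrightarrow> card D > n \<longrightarrow> finite {s. \<forall>d\<in>D. s + d \<in> B}"
    using assms(2) unfolding thin_def ..
  show ?thesis unfolding thin_def
  proof (intro exI[of _ "m + n"] allI impI)
    fix D :: "nat set" assume D: "finite D" "card D > m + n"
    let ?SA = "{E. E \<subseteq> D \<and> card E > m}" and ?SB = "{E. E \<subseteq> D \<and> card E > n}"
    have "finite ((\<Union>E\<in>?SA. {s. \<forall>d\<in>E. s + d \<in> A}) \<union> (\<Union>E\<in>?SB. {s. \<forall>d\<in>E. s + d \<in> B}))"
      using D(1) by (intro finite_UnI finite_UN_I) (auto intro!: m[rule_format] n[rule_format] intro: finite_subset)
    moreover have "{s. \<forall>d\<in>D. s + d \<in> A \<union> B} \<subseteq> \<dots>"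
    proof
      fix s assume s: "s \<in> {s. \<forall>d\<in>D. s + d \<in> A \<union> B}"
      define E F where "E = {d\<in>D. s + d \<in> A}" and "F = {d\<in>D. s + d \<in> B}"
      have "D = E \<union> F" using s by (auto simp: E_def F_def)
      hence "card D \<le> card E + card F" by (metis card_Un_le)
      hence "card E > m \<or> card F > n" using D(2) by linarith
      hence "E \<in> ?SA \<or> F \<in> ?SB" by (auto simp: E_def F_def)
      moreover have "\<forall>d\<in>E. s + d \<in> A" "\<forall>d\<in>F. s + d \<in> B" by (auto simp: E_def F_def)
      ultimately show "s \<in> (\<Union>E\<in>?SA. {s. \<forall>d\<in>E. s + d \<in> A}) \<union> (\<Union>E\<in>?SB. {s. \<forall>d\<in>E. s + d \<in> B})"
        by blast
    qed
    ultimately show "finite {s. \<forall>d\<in>D. s + d \<in> A \<union> B}" by (rule rev_finite_subset)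
  qed
qed

lemma thin_UN: "finite I \<Longrightarrow> (\<And>i. i \<in> I \<Longrightarrow> thin (A i)) \<Longrightarrow> thin (\<Union>i\<in>I. A i)"
  by (induction I rule: finite_induct) (auto intro: thin_Un thin_finite)

lemma not_thin_UNIV: "\<not> thin UNIV"
proof
  assume "thin UNIV"
  then obtain m where "\<forall>D. finite D \<longrightarrow> card D > m \<longrightarrow> finite {s :: nat. \<forall>d\<in>D. s + d \<in> UNIV}"
    unfolding thin_def ..
  from this[rule_format, of "{..m}"] show False by simp
qed

text \<open>Lagrange interpolation at the nodes \<open>D\<close> gives the coefficient of degree
  \<open>e\<close> as the sum of the quotients of \<open>q\<close> at \<open>d\<close> by
  \<open>\<delta> d\<close>. Multiplying by the product \<open>W\<close> of all
  \<open>\<delta> d\<close> makes the weights integral.\<close>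

lemma divided_difference:
  fixes D :: "nat set"
  assumes D: "finite D" "card D = Suc e"
  obtains w :: "nat \<Rightarrow> int" and W :: int where "W \<noteq> 0"
    "\<And>q :: complex poly. degree q \<le> e \<Longrightarrow> (\<Sum>d\<in>D. of_int (w d) * poly q (of_nat d)) = of_int W * coeff q e"
proof -
  define \<delta> where "\<delta> d = (\<Prod>x\<in>D-{d}. int d - int x)" for d
  define w where "w d = (\<Prod>x\<in>D-{d}. \<delta> x)" for d
  define W where "W = (\<Prod>x\<in>D. \<delta> x)"
  have \<delta>0: "\<delta> d \<noteq> 0" for d using D(1) by (auto simp: \<delta>_def)
  have W: "W = \<delta> d * w d" if "d \<in> D" for d
    unfolding W_def w_def using D(1) that by (rule prod.remove)
  have W0: "W \<noteq> 0" using D(1) \<delta>0 by (simp add: W_def)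
  define l where "l d = (\<Prod>x\<in>D-{d}. [:- of_nat x, 1:] :: complex poly)" for d
  have dl: "degree (l d) = e" "lead_coeff (l d) = 1" if "d \<in> D" for d
  proof -
    have "degree (l d) = (\<Sum>x\<in>D-{d}. degree [:- of_nat x, 1 :: complex:])"
      unfolding l_def by (rule degree_prod_eq_sum_degree) auto
    thus "degree (l d) = e" using D that by simp
    show "lead_coeff (l d) = 1" unfolding l_def lead_coeff_prod by simp
  qed
  have lx: "poly (l d) (of_nat x) = (if x = d then of_int (\<delta> d) else 0)" if "d \<in> D" "x \<in> D" for d x
    unfolding l_def \<delta>_def poly_prod using D(1) that by (auto intro!: prod.cong prod_zero)
  show ?thesis
  proof (rule that[OF W0])
    fix q :: "complex poly" assume q: "degree q \<le> e"
    define r where "r = (\<Sum>d\<in>D. smult (poly q (of_nat d) / of_int (\<delta> d)) (l d))"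
    have "degree r \<le> e" unfolding r_def
      by (intro degree_sum_le D(1)) (metis degree_smult_le dl(1))
    moreover have "poly r (of_nat x) = poly q (of_nat x)" if "x \<in> D" for x
    proof -
      have "poly r (of_nat x) = (\<Sum>d\<in>D. if d = x then poly q (of_nat x) else 0)"
        unfolding r_def poly_sum using that \<delta>0 by (intro sum.cong) (auto simp: lx)
      thus ?thesis using that D(1) by simp
    qed
    ultimately have "q = r" using q D
      by (intro poly_eqI_degree[of "of_nat ` D"]) (auto simp: card_image inj_on_def)
    have "coeff q e = (\<Sum>d\<in>D. poly q (of_nat d) / of_int (\<delta> d))"
      unfolding \<open>q = r\<close>[THEN arg_cong[of _ _ "\<lambda>p. coeff p e"]] r_def coeff_sum
      using dl by (intro sum.cong) auto
    hence "of_int W * coeff q e = (\<Sum>d\<in>D. of_int W * (poly q (of_nat d) / of_int (\<delta> d)))"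
      by (simp only: sum_distrib_left)
    also have "\<dots> = (\<Sum>d\<in>D. of_int (w d) * poly q (of_nat d))"
      using \<delta>0 by (intro sum.cong) (auto simp: W)
    finally show "(\<Sum>d\<in>D. of_int (w d) * poly q (of_nat d)) = of_int W * coeff q e" ..
  qed
qed

section \<open>Integral values of sequences asymptotic to polynomials\<close>

lemma common_denominator:
  assumes "finite I" "\<And>i. i \<in> I \<Longrightarrow> c i \<in> (\<rat> :: 'a :: field_char_0 set)"
  obtains M :: int where "M \<noteq> 0" "\<And>i. i \<in> I \<Longrightarrow> of_int M * c i \<in> \<int>"
proof -
  have "\<exists>M :: int. M \<noteq> 0 \<and> (\<forall>i\<in>I. of_int M * c i \<in> \<int>)"
    using assms
  proof (induction I rule: finite_induct)
    case empty
    show ?case by (intro exI[of _ 1]) auto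
  next
    case (insert i I)
    then obtain M :: int where M: "M \<noteq> 0" "\<And>j. j \<in> I \<Longrightarrow> of_int M * c j \<in> \<int>" by auto
    from insert.prems[of i] obtain a b :: int where ab: "b > 0" "c i = of_int a / of_int b"
      by (auto elim!: Rats_cases')
    have "of_int (M * b) * c i = of_int (M * a)" using ab by simp
    moreover have "of_int (M * b) * c j = of_int b * (of_int M * c j)" for j by simp
    ultimately have "of_int (M * b) * c j \<in> \<int>" if "j \<in> insert i I" for j
      using that M(2)[of j] by (metis Ints_mult Ints_of_int insert_iff)
    thus ?case using ab M(1) by (intro exI[of _ "M * b"]) auto
  qed
  thus ?thesis using that by blast
qed

text \<open>Distinct integers are at least 1 apart. An integral value within 1/2 of \<open>l\<close>
  must equal \<open>l\<close>, since otherwise a strictly closer integral value would coincide with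
  it.\<close>

lemma Ints_limit:
  fixes v :: "nat \<Rightarrow> complex"
  assumes "v \<longlonglongrightarrow> l" "infinite {s. v s \<in> \<int>}"
  shows "l \<in> \<int>"
proof -
  have close: "\<exists>s. v s \<in> \<int> \<and> norm (v s - l) < e" if "e > 0" for e
  proof -
    from LIMSEQ_D[OF assms(1) that] obtain s0 where "\<And>s. s \<ge> s0 \<Longrightarrow> norm (v s - l) < e" by blast
    moreover from assms(2) obtain s where "s \<ge> s0" "v s \<in> \<int>"
      by (metis (mono_tags) infinite_nat_iff_unbounded_le mem_Collect_eq)
    ultimately show ?thesis by blast
  qed
  from close[of "1/2"] obtain s where s: "v s \<in> \<int>" "norm (v s - l) < 1/2" by auto
  have "v s = l"
  proof (rule ccontr)
    assume "v s \<noteq> l"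
    hence "norm (v s - l) > 0" by simp
    from close[OF this] obtain t where t: "v t \<in> \<int>" "norm (v t - l) < norm (v s - l)" by blast
    have "norm (v s - v t) \<le> norm (v s - l) + norm (v t - l)"
      using norm_triangle_ineq4[of "v s - l" "v t - l"] by simp
    also have "\<dots> < 1" using s t by simp
    finally have "norm (v s - v t) < 1" .
    moreover obtain k :: int where k: "v s - v t = of_int k" using Ints_diff[OF s(1) t(1)] by (auto elim: Ints_cases)
    ultimately have "norm (of_int k :: complex) < 1" by simp
    hence "k = 0" by simp
    with k have "v s = v t" by simp
    with t show False by simp
  qed
  with s(1) show ?thesis by simp
qed

text \<open>Let \<open>e\<close> be the largest exponent with an irrational coefficient. The terms
  above it become integral after scaling by \<open>M\<close> and are subtracted; a divided
  difference of order \<open>e\<close> of the rest tends to a nonzero integer times that irrational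
  coefficient, so it cannot be integral infinitely often.\<close>

lemma thin_Ints_irrational:
  fixes p :: "complex poly"
  assumes lim: "(\<lambda>s. v s - poly p (of_nat s)) \<longlonglongrightarrow> 0" and irr: "coeff p i \<notin> \<rat>"
  shows "thin {s. v s \<in> \<int>}"
proof -
  define e where "e = Max {i. coeff p i \<notin> \<rat>}"
  have fin: "finite {i. coeff p i \<notin> \<rat>}"
    by (rule finite_subset[of _ "{..degree p}"]) (auto intro: le_degree)
  have e: "coeff p e \<notin> \<rat>" using Max_in[OF fin] irr unfolding e_def by auto
  have gt: "coeff p i \<in> \<rat>" if "i > e" for i
    using Max_ge[OF fin, of i] that unfolding e_def by force
  obtain M :: int where M: "M \<noteq> 0" "\<And>i. i \<in> {e<..degree p} \<Longrightarrow> of_int M * coeff p i \<in> \<int>"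
    using common_denominator[of "{e<..degree p}" "coeff p"] gt by auto
  define lo where "lo = (\<Sum>i\<le>e. monom (coeff p i) i)"
  define hi where "hi = p - lo"
  have clo: "coeff lo i = (if i \<le> e then coeff p i else 0)" for i
    unfolding lo_def by (simp add: coeff_sum)
  have dlo: "degree lo = e"
  proof (rule antisym)
    show "degree lo \<le> e" by (rule degree_le) (auto simp: clo)
    show "e \<le> degree lo" by (rule le_degree) (use e in \<open>auto simp: clo\<close>)
  qed
  have hi: "of_int M * poly hi (of_nat s) \<in> \<int>" for s
  proof -
    have "of_int M * coeff hi i \<in> \<int>" for i
      using M(2)[of i] by (cases "i \<le> degree p") (auto simp: hi_def clo coeff_eq_0)
    hence "(\<Sum>i\<le>degree hi. (of_int M * coeff hi i) * of_nat s ^ i) \<in> \<int>"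
      by (intro Ints_sum Ints_mult[OF _ Ints_power[OF Ints_of_nat]]) auto
    thus ?thesis by (simp add: poly_altdef sum_distrib_left mult_ac)
  qed
  show ?thesis unfolding thin_def
  \<comment> \<open>A divided difference of order \<open>e\<close> needs \<open>Suc e\<close> nodes,
    hence the bound \<open>e\<close>.\<close>
  proof (intro exI[of _ e] allI impI)
    fix D :: "nat set" assume D: "finite D" "card D > e"
    then obtain D' where D': "D' \<subseteq> D" "card D' = Suc e" "finite D'"
      by (meson obtain_subset_with_card_n Suc_leI finite_subset)
    obtain w :: "nat \<Rightarrow> int" and W :: int where W: "W \<noteq> 0" and
      w: "\<And>q :: complex poly. degree q \<le> e \<Longrightarrow> (\<Sum>d\<in>D'. of_int (w d) * poly q (of_nat d)) = of_int W * coeff q e"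
      by (rule divided_difference[OF D'(3,2)]) blast
    define L where "L s = (\<Sum>d\<in>D'. of_int (w d) * (of_int M * v (s + d) - of_int M * poly hi (of_nat (s + d))))" for s
    define c where "c = of_int M * of_int W * coeff p e"
    have L: "L s = c + (\<Sum>d\<in>D'. of_int (w d) * (of_int M * (v (s + d) - poly p (of_nat (s + d)))))" for s
    proof -
      \<comment> \<open>Translating \<open>lo\<close> by \<open>s\<close> keeps its top coefficient,
        so the divided difference contributes the constant \<open>c\<close> for every
        \<open>s\<close>.\<close>
      define q where "q = pcompose lo [:of_nat s, 1:]"
      have q: "degree q = e" unfolding q_def by (simp add: degree_pcompose dlo)
      have "lead_coeff q = lead_coeff lo" unfolding q_def by (subst lead_coeff_comp) auto
      hence "coeff q e = coeff p e" by (simp add: q dlo clo)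
      with w[of q] q have "(\<Sum>d\<in>D'. of_int (w d) * poly q (of_nat d)) = of_int W * coeff p e" by simp
      moreover have "poly q (of_nat d) = poly lo (of_nat (s + d))" for d
        by (simp add: q_def poly_pcompose)
      ultimately have "c = (\<Sum>d\<in>D'. of_int (w d) * (of_int M * poly lo (of_nat (s + d))))"
        by (simp add: c_def mult.assoc[symmetric] mult.commute[of "of_int M"] flip: sum_distrib_right)
      thus ?thesis unfolding L_def
        by (simp add: hi_def algebra_simps sum_subtractf sum.distrib)
    qed
    have "(\<lambda>s. c + (\<Sum>d\<in>D'. of_int (w d) * (of_int M * (v (s + d) - poly p (of_nat (s + d))))))
        \<longlonglongrightarrow> c + (\<Sum>d\<in>D'. of_int (w d) * (of_int M * 0))"
      by (intro tendsto_intros) (rule LIMSEQ_ignore_initial_segment[OF lim])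
    hence lim: "L \<longlonglongrightarrow> c" by (simp add: L[abs_def])
    show "finite {s. \<forall>d\<in>D. s + d \<in> {s. v s \<in> \<int>}}"
    proof (rule ccontr)
      assume "infinite {s. \<forall>d\<in>D. s + d \<in> {s. v s \<in> \<int>}}"
      moreover have "{s. \<forall>d\<in>D. s + d \<in> {s. v s \<in> \<int>}} \<subseteq> {s. L s \<in> \<int>}"
      proof
        fix s assume s: "s \<in> {s. \<forall>d\<in>D. s + d \<in> {s. v s \<in> \<int>}}"
        have "of_int (w d) * (of_int M * v (s + d) - of_int M * poly hi (of_nat (s + d))) \<in> \<int>" if "d \<in> D'" for d
          by (rule Ints_mult[OF _ Ints_diff[OF Ints_mult hi]]) (use s that D' in auto)
        thus "s \<in> {s. L s \<in> \<int>}" by (auto simp: L_def intro!: Ints_sum)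
      qed
      ultimately have "infinite {s. L s \<in> \<int>}" using finite_subset by blast
      from Ints_limit[OF lim this] have "c \<in> \<rat>" using Ints_subset_Rats by blast
      hence "c / (of_int M * of_int W) \<in> \<rat>" by (intro Rats_divide Rats_mult) auto
      thus False using e M(1) W by (simp add: c_def)
    qed
  qed
qed

text \<open>Whenever \<open>v s\<close> is integral, so is \<open>M\<close> times the error
  \<open>v s - poly p (of_nat s)\<close>. This product tends to 0 and is eventually nonzero, so it
  is eventually not integral.\<close>

lemma finite_Ints_rational:
  fixes p :: "complex poly"
  assumes lim: "(\<lambda>s. v s - poly p (of_nat s)) \<longlonglongrightarrow> 0" and rat: "\<And>i. coeff p i \<in> \<rat>"
    and ne: "eventually (\<lambda>s. v s \<noteq> poly p (of_nat s)) sequentially"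
  shows "finite {s. v s \<in> \<int>}"
proof -
  obtain M :: int where M: "M \<noteq> 0" "\<And>i. i \<le> degree p \<Longrightarrow> of_int M * coeff p i \<in> \<int>"
    using common_denominator[of "{..degree p}" "coeff p"] rat by auto
  have p: "of_int M * poly p (of_nat s) \<in> \<int>" for s
  proof -
    have "(\<Sum>i\<le>degree p. (of_int M * coeff p i) * of_nat s ^ i) \<in> \<int>"
      using M by (intro Ints_sum Ints_mult[OF _ Ints_power[OF Ints_of_nat]]) auto
    thus ?thesis by (simp add: poly_altdef sum_distrib_left mult_ac)
  qed
  have "(\<lambda>s. of_int M * (v s - poly p (of_nat s))) \<longlonglongrightarrow> of_int M * 0"
    by (intro tendsto_intros lim)
  hence "eventually (\<lambda>s. norm (of_int M * (v s - poly p (of_nat s))) < 1) sequentially"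
    by (intro order_tendstoD(2)[OF tendsto_norm_zero]) auto
  with ne have "eventually (\<lambda>s. v s \<notin> \<int>) sequentially"
  proof eventually_elim
    case (elim s)
    show ?case
    proof
      assume "v s \<in> \<int>"
      hence "of_int M * v s - of_int M * poly p (of_nat s) \<in> \<int>" using p by (intro Ints_diff) auto
      hence "of_int M * (v s - poly p (of_nat s)) \<in> \<int>" by (simp add: algebra_simps)
      then obtain k :: int where k: "of_int M * (v s - poly p (of_nat s)) = of_int k" by (auto elim: Ints_cases)
      with elim have "k = 0" by simp
      with k elim M show False by simp
    qed
  qed
  then obtain s0 where "\<And>s. s \<ge> s0 \<Longrightarrow> v s \<notin> \<int>" by (auto simp: eventually_sequentially)
  hence "{s. v s \<in> \<int>} \<subseteq> {..<s0}" by (auto simp: not_le[symmetric])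
  thus ?thesis by (rule finite_subset) simp
qed

text \<open>Multiplication by the power \<open>K\<close> of \<open>s\<close> turns the terms of
  order at most \<open>K\<close> into a polynomial in \<open>s\<close> and leaves a tail tending to
  0. Either the polynomial has an irrational coefficient, or it is rational and the tail is
  eventually nonzero.\<close>

lemma thin_Ints_asym:
  assumes u: "\<And>N. asym_upto N u a"
    and a: "(\<exists>k\<le>K. a $ k \<notin> \<rat>) \<or> (\<exists>k>K. a $ k \<noteq> 0)"
  shows "thin {s. of_nat s ^ K * u s \<in> \<int>}"
proof -
  define p where "p = (\<Sum>k\<le>K. monom (a $ k) (K - k))"
  have cp: "coeff p i = (if i \<le> K then a $ (K - i) else 0)" for i
  proof -
    have "coeff p i = (\<Sum>k\<le>K. if i \<le> K \<and> k = K - i then a $ k else 0)"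
      unfolding p_def coeff_sum coeff_monom by (intro sum.cong) auto
    thus ?thesis by (cases "i \<le> K") auto
  qed
  have pp: "poly p (of_nat s) = (\<Sum>k\<le>K. a $ k / of_nat s ^ k) * of_nat s ^ K" if "s > 0" for s
    unfolding p_def poly_sum poly_monom sum_distrib_right using that
    by (intro sum.cong) (auto simp: power_diff)
  have "(\<lambda>s. (u s - (\<Sum>k<K. a $ k / of_nat s ^ k)) * of_nat s ^ K - a $ K) \<longlonglongrightarrow> a $ K - a $ K"
    by (intro tendsto_diff tendsto_const asym_upto_limit u)
  moreover have "(u s - (\<Sum>k<K. a $ k / of_nat s ^ k)) * of_nat s ^ K - a $ K =
      of_nat s ^ K * u s - poly p (of_nat s)" if "s > 0" for s
    using that by (simp add: pp lessThan_Suc_atMost[symmetric] algebra_simps)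
  ultimately have lim: "(\<lambda>s. of_nat s ^ K * u s - poly p (of_nat s)) \<longlonglongrightarrow> 0"
    by (auto elim!: Lim_transform_eventually intro: eventually_mono[OF eventually_gt_at_top[of 0]])
  show ?thesis
  proof (cases "\<exists>k\<le>K. a $ k \<notin> \<rat>")
    case True
    then obtain k where "k \<le> K" "a $ k \<notin> \<rat>" by auto
    hence "coeff p (K - k) \<notin> \<rat>" by (simp add: cp)
    from thin_Ints_irrational[OF lim this] show ?thesis .
  next
    case False
    hence rat: "coeff p i \<in> \<rat>" for i by (auto simp: cp)
    \<comment> \<open>The first nonzero tail coefficient: truncating before it leaves just the
      polynomial part, and the rescaled remainder tends to \<open>a $ k\<close>, so it is eventually
      nonzero.\<close>
    define k where "k = (LEAST k. k > K \<and> a $ k \<noteq> 0)"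
    have k: "k > K \<and> a $ k \<noteq> 0"
      unfolding k_def by (rule LeastI_ex) (use a False in blast)
    have less: "a $ j = 0" if "K < j" "j < k" for j
      using not_less_Least[of j "\<lambda>k. k > K \<and> a $ k \<noteq> 0"] that unfolding k_def by auto
    have sm: "(\<Sum>j<k. a $ j / of_nat s ^ j) = (\<Sum>j\<le>K. a $ j / of_nat s ^ j)" for s
      using k less by (intro sum.mono_neutral_right) (auto simp: not_le)
    have "eventually (\<lambda>s. (u s - (\<Sum>j<k. a $ j / of_nat s ^ j)) * of_nat s ^ k \<noteq> 0) sequentially"
      by (rule tendsto_imp_eventually_ne[OF asym_upto_limit[OF u]]) (use k in auto)
    with eventually_gt_at_top[of 0]
    have "eventually (\<lambda>s. of_nat s ^ K * u s \<noteq> poly p (of_nat s)) sequentially"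
      by eventually_elim (auto simp: sm pp)
    from finite_Ints_rational[OF lim rat this] show ?thesis by (rule thin_finite)
  qed
qed

section \<open>Expansions of the roots\<close>

lemma map_poly_of_rat_eq_0_iff [simp]:
  "map_poly (of_rat :: rat \<Rightarrow> 'a :: field_char_0) p = 0 \<longleftrightarrow> p = 0"
  by (auto simp: poly_eq_iff coeff_map_poly)

lemma coeff_map_poly_ring_map: "ring_map h \<Longrightarrow> coeff (map_poly h p) n = h (coeff p n)"
  by (simp add: coeff_map_poly ring_map.map_zero)

text \<open>The Taylor expansion of \<open>p\<close> at \<open>b\<close>, that is
  \<open>p(b + t)\<close> as a series in \<open>t\<close>; the substitution t = 1/s turns it into an
  asymptotic expansion.\<close>

definition expand_at :: "rat \<Rightarrow> rat poly \<Rightarrow> complex fps" where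
  "expand_at b p = fps_of_poly (map_poly of_rat (pcompose p [:b, 1:]))"

lemma ring_map_expand_at: "ring_map (expand_at b)"
proof -
  interpret r: ring_map "of_rat :: rat \<Rightarrow> complex" by (rule ring_map_of_rat)
  show ?thesis
    by unfold_locales
       (simp_all add: expand_at_def pcompose_1 pcompose_add pcompose_mult r.map_poly_add r.map_poly_mult
         fps_of_poly_add fps_of_poly_mult)
qed

lemma expand_at_eq_0_iff: "expand_at b p = 0 \<longleftrightarrow> p = 0"
  by (simp add: expand_at_def pcompose_eq_0_iff)

text \<open>Used to pull a rational polynomial in \<open>t\<close> back to one in X = b + t.\<close>

lemma expand_at_pcompose: "expand_at b (pcompose q [:-b, 1:]) = fps_of_poly (map_poly of_rat q)"
  by (simp add: expand_at_def pcompose_assoc[symmetric] pcompose_pCons)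

lemma expand_at_nth_0: "expand_at b p $ 0 = of_rat (poly p b)"
  by (simp add: expand_at_def coeff_map_poly)

lemma asym_expand_at: "asym_upto N (\<lambda>s. of_rat (poly p (b + 1 / of_nat s))) (expand_at b p)"
proof -
  interpret r: ring_map "of_rat :: rat \<Rightarrow> complex" by (rule ring_map_of_rat)
  have "poly (map_poly of_rat (pcompose p [:b, 1:])) (1 / of_nat s) =
      (of_rat (poly p (b + 1 / of_nat s)) :: complex)" for s
    using r.poly_map_poly[of "pcompose p [:b, 1:]" "1 / of_nat s"]
    by (simp add: poly_pcompose of_rat_divide)
  thus ?thesis using asym_upto_poly[of N "map_poly of_rat (pcompose p [:b, 1:])"]
    by (simp add: expand_at_def)
qed

lemma asym_poly_map_poly:
  assumes "\<And>s. ring_map (g s)" "ring_map h" "\<And>q. asym_upto N (\<lambda>s. g s q) (h q)" "asym_upto N z a"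
  shows "asym_upto N (\<lambda>s. poly (map_poly (g s) F) (z s)) (poly (map_poly h F) a)"
proof (induction F)
  case 0
  show ?case using asym_upto_const[of N 0] by simp
next
  case (pCons c F)
  have "asym_upto N (\<lambda>s. g s c + z s * poly (map_poly (g s) F) (z s)) (h c + a * poly (map_poly h F) a)"
    by (rule asym_upto_add[OF assms(3) asym_upto_mult[OF assms(4) pCons.IH]])
  thus ?case using assms(1,2) by (simp add: map_poly_pCons ring_map.map_zero)
qed

lemma asym_truncation:
  "asym_upto N (\<lambda>s. \<Sum>k<m. a $ k / of_nat s ^ k) (fps_cutoff m a)"
proof -
  define p where "p = (\<Sum>k<m. monom (a $ k) k)"
  have "fps_of_poly p = fps_cutoff m a"
    by (rule fps_ext) (simp add: p_def coeff_sum)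
  moreover have "poly p (1 / of_nat s) = (\<Sum>k<m. a $ k / of_nat s ^ k)" for s
    by (simp add: p_def poly_sum poly_monom power_divide)
  ultimately show ?thesis using asym_upto_poly[of N p] by simp
qed

lemma asym_vanishing_bigo:
  assumes "asym_upto N u a" "\<And>k. k < N \<Longrightarrow> a $ k = 0"
  shows "u \<in> O(\<lambda>s. 1 / of_nat s ^ N)"
  using assms by (simp add: asym_upto_def)

lemma asym_coeff_prod_linear:
  assumes "finite S" "\<And>\<alpha>. \<alpha> \<in> S \<Longrightarrow> asym_upto N (r \<alpha>) (y \<alpha>)"
  shows "asym_upto N (\<lambda>s. coeff (\<Prod>\<alpha>\<in>S. [:- r \<alpha> s, 1:]) j) (coeff (\<Prod>\<alpha>\<in>S. [:- y \<alpha>, 1:]) j)"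
  using assms
proof (induction S arbitrary: j rule: finite_induct)
  case empty
  have "asym_upto N (\<lambda>_. if j = 0 then 1 else 0) (fps_const (if j = 0 then 1 else 0))"
    by (rule asym_upto_const)
  thus ?case by (cases j) auto
next
  case (insert \<alpha> S)
  have lin: "coeff ([:- c, 1:] * p) j = (-c) * coeff p j + (case j of 0 \<Rightarrow> 0 | Suc i \<Rightarrow> coeff p i)"
    for c :: "'b :: comm_ring_1" and p j by (auto simp: coeff_pCons split: nat.splits)
  have IH: "asym_upto N (\<lambda>s. coeff (\<Prod>\<alpha>\<in>S. [:- r \<alpha> s, 1:]) i) (coeff (\<Prod>\<alpha>\<in>S. [:- y \<alpha>, 1:]) i)" for i
    using insert by auto
  have "asym_upto N (\<lambda>s. - r \<alpha> s) (- y \<alpha>)"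
  proof -
    have "fps_const (-1) * y \<alpha> = - y \<alpha>" by (rule fps_ext) simp
    thus ?thesis using asym_upto_cmult[of N "r \<alpha>" "y \<alpha>" "-1"] insert.prems by simp
  qed
  moreover have "asym_upto N
      (\<lambda>s. case j of 0 \<Rightarrow> 0 | Suc i \<Rightarrow> coeff (\<Prod>\<alpha>\<in>S. [:- r \<alpha> s, 1:]) i)
      (case j of 0 \<Rightarrow> 0 | Suc i \<Rightarrow> coeff (\<Prod>\<alpha>\<in>S. [:- y \<alpha>, 1:]) i)"
    using IH asym_upto_const[of N 0] by (cases j) auto
  ultimately show ?case
    unfolding prod.insert[OF insert.hyps] lin by (intro asym_upto_add asym_upto_mult IH)
qed

text \<open>The value at \<open>z\<close> is the leading coefficient times the product of the
  differences to the roots, and each factor is at least the smallest distance in norm.\<close>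

lemma exists_near_root:
  fixes P :: "complex poly"
  assumes "degree P > 0"
  obtains x where "poly P x = 0" "norm (lead_coeff P) * norm (z - x) ^ degree P \<le> norm (poly P z)"
proof -
  have "P \<noteq> 0" using assms by auto
  then obtain A where A: "size A = degree P" "P = smult (lead_coeff P) (\<Prod>x\<in>#A. [:-x, 1:])"
    using alg_closed_imp_factorization by blast
  have ev: "poly P w = lead_coeff P * (\<Prod>x\<in>#A. w - x)" for w
    by (subst A(2)) (simp add: poly_prod_mset image_mset.compositionality o_def algebra_simps)
  define m where "m = Min ((\<lambda>x. norm (z - x)) ` set_mset A)"
  have "A \<noteq> {#}" using A(1) assms by auto
  hence "m \<in> (\<lambda>x. norm (z - x)) ` set_mset A" unfolding m_def by (intro Min_in) auto
  then obtain x where x: "x \<in># A" "m = norm (z - x)" by auto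
  have m: "m \<le> norm (z - x)" if "x \<in># A" for x unfolding m_def using that by (intro Min_le) auto
  \<comment> \<open>The induction runs over submultisets of \<open>A\<close>, because
    \<open>m\<close> bounds only the distances to members of \<open>A\<close>.\<close>
  have "m ^ size B \<le> norm (\<Prod>x\<in>#B. z - x)" if "B \<subseteq># A" for B
    using that
  proof (induction B)
    case (add x B)
    have "x \<in># A" by (rule mset_subset_eqD[OF add.prems]) simp
    moreover have "B \<subseteq># A" by (rule subset_mset.trans[OF _ add.prems]) simp
    ultimately have "m * m ^ size B \<le> norm (z - x) * norm (\<Prod>x\<in>#B. z - x)"
      using add.IH m x(2) by (intro mult_mono) auto
    thus ?case by (simp add: norm_mult)
  qed auto
  from this[of A] have "norm (lead_coeff P) * m ^ degree P \<le> norm (poly P z)"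
    unfolding ev norm_mult A(1)[symmetric] by (intro mult_left_mono) auto
  moreover have "poly P x = 0" using x(1) by (auto simp: ev prod_mset_zero_iff)
  ultimately show ?thesis using that x(2) by blast
qed

lemma exists_separation:
  fixes A :: "complex set"
  assumes "finite A"
  obtains e where "e > 0" "\<And>x y. x \<in> A \<Longrightarrow> y \<in> A \<Longrightarrow> x \<noteq> y \<Longrightarrow> 2 * e \<le> dist x y"
proof -
  \<comment> \<open>The extra 1 keeps \<open>D\<close> nonempty when \<open>A\<close> has no two
    distinct points.\<close>
  define D where "D = insert 1 ((\<lambda>(x, y). dist x y) ` {(x, y). x \<in> A \<and> y \<in> A \<and> x \<noteq> y})"
  have "finite {(x, y). x \<in> A \<and> y \<in> A \<and> x \<noteq> y}"
    by (rule finite_subset[of _ "A \<times> A"]) (use assms in auto)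
  hence "finite D" by (simp add: D_def)
  hence "Min D > 0" by (subst Min_gr_iff) (auto simp: D_def)
  moreover have "Min D \<le> dist x y" if "x \<in> A" "y \<in> A" "x \<noteq> y" for x y
    by (rule Min_le[OF \<open>finite D\<close>]) (use that in \<open>auto simp: D_def\<close>)
  ultimately show ?thesis by (intro that[of "Min D / 2"]) auto
qed

definition complex_spec :: "rat poly poly \<Rightarrow> rat \<Rightarrow> complex poly" where
  "complex_spec f b = map_poly (\<lambda>q. of_rat (poly q b)) f"

lemma ring_map_of_rat_poly: "ring_map (\<lambda>q. of_rat (poly q b) :: complex)"
  by (rule ring_map_comp[OF ring_map_of_rat ring_map_poly])

lemma coeff_complex_spec: "coeff (complex_spec f b) j = of_rat (poly (coeff f j) b)"
  unfolding complex_spec_def by (rule coeff_map_poly_ring_map[OF ring_map_of_rat_poly])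

lemma degree_complex_spec:
  assumes "poly (lead_coeff f) b \<noteq> 0"
  shows "degree (complex_spec f b) = degree f"
proof (rule antisym)
  show "degree (complex_spec f b) \<le> degree f"
    by (rule degree_le) (auto simp: coeff_complex_spec coeff_eq_0)
  show "degree f \<le> degree (complex_spec f b)"
    by (rule le_degree) (use assms in \<open>simp add: coeff_complex_spec\<close>)
qed

text \<open>Roots of the squarefree specialization are simple, so each lifts to a formal root
  \<open>y \<alpha>\<close>. Its truncations lie close to genuine roots at b + 1/s, and disjoint
  discs around the \<open>\<alpha>\<close> make these roots unique and account for all of
  them.\<close>

lemma root_expansions:
  fixes f :: "rat poly poly" and b :: rat
  defines "R \<equiv> {x. poly (complex_spec f b) x = 0}" and "b' \<equiv> (\<lambda>s::nat. b + 1 / of_nat s)"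
  assumes deg: "degree f > 0" and lc: "poly (lead_coeff f) b \<noteq> 0"
    and sqf: "rsquarefree (complex_spec f b)"
  obtains y r where
    "\<And>\<alpha>. \<alpha> \<in> R \<Longrightarrow> poly (map_poly (expand_at b) f) (y \<alpha>) = 0"
    "\<And>\<alpha> N. \<alpha> \<in> R \<Longrightarrow> asym_upto N (r \<alpha>) (y \<alpha>)"
    "eventually (\<lambda>s. poly (lead_coeff f) (b' s) \<noteq> 0 \<and> inj_on (\<lambda>\<alpha>. r \<alpha> s) R \<and>
       complex_spec f (b' s) = smult (of_rat (poly (lead_coeff f) (b' s))) (\<Prod>\<alpha>\<in>R. [:- r \<alpha> s, 1:])) sequentially"
proof -
  define n where "n = degree f"
  define P where "P s = complex_spec f (b' s)" for s
  define lcf where "lcf s = (of_rat (poly (lead_coeff f) (b' s)) :: complex)" for s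
  interpret E: ring_map "expand_at b" by (rule ring_map_expand_at)
  have cs0: "complex_spec f b = map_poly (\<lambda>a. a $ 0) (map_poly (expand_at b) f)"
    by (simp add: complex_spec_def map_poly_map_poly o_def expand_at_nth_0)
  have nz: "complex_spec f b \<noteq> 0" using degree_complex_spec[OF lc] deg by auto
  have fin: "finite R" unfolding R_def using nz by (rule poly_roots_finite)
  have card: "card R = n"
  proof -
    have "complex_spec f b = smult (lead_coeff (complex_spec f b)) (\<Prod>x\<in>R. [:-x, 1:])"
      unfolding R_def by (rule complex_poly_decompose_rsquarefree[OF sqf, symmetric])
    hence "degree (complex_spec f b) = degree (\<Prod>x\<in>R. [:-x, 1:])"
      using nz by (metis degree_smult_eq leading_coeff_0_iff)
    also have "\<dots> = card R" by (subst degree_prod_eq_sum_degree) auto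
    finally show ?thesis using degree_complex_spec[OF lc] by (simp add: n_def)
  qed
  have "\<forall>\<alpha>\<in>R. \<exists>y. poly (map_poly (expand_at b) f) y = 0 \<and> y $ 0 = \<alpha>"
  proof
    fix \<alpha> assume "\<alpha> \<in> R"
    hence 1: "poly (map_poly (\<lambda>a. a $ 0) (map_poly (expand_at b) f)) \<alpha> = 0"
      by (simp add: R_def cs0)
    have "pderiv (complex_spec f b) = map_poly (\<lambda>a. a $ 0) (pderiv (map_poly (expand_at b) f))"
      unfolding cs0 by (rule ring_map.map_poly_pderiv[OF ring_map_fps_nth_0, symmetric])
    moreover have "poly (pderiv (complex_spec f b)) \<alpha> \<noteq> 0"
      using sqf \<open>\<alpha> \<in> R\<close> unfolding rsquarefree_roots R_def by auto
    ultimately have "poly (map_poly (\<lambda>a. a $ 0) (pderiv (map_poly (expand_at b) f))) \<alpha> \<noteq> 0"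
      by simp
    from fps_hensel[OF 1 this] show "\<exists>y. poly (map_poly (expand_at b) f) y = 0 \<and> y $ 0 = \<alpha>" by blast
  qed
  then obtain y where y: "\<forall>\<alpha>\<in>R. poly (map_poly (expand_at b) f) (y \<alpha>) = 0 \<and> y \<alpha> $ 0 = \<alpha>"
    by (rule bchoice[THEN exE])
  define z where "z m \<alpha> s = (\<Sum>k<m. y \<alpha> $ k / of_nat s ^ k)" for m \<alpha> and s :: nat
  have z_asym: "asym_upto N (z m \<alpha>) (fps_cutoff m (y \<alpha>))" for N m \<alpha>
    unfolding z_def by (rule asym_truncation)

  have "lcf \<longlonglongrightarrow> of_rat (poly (lead_coeff f) b)"
    using asym_upto_limit[OF asym_expand_at[of "Suc 0" "lead_coeff f" b]]
    by (simp add: lcf_def[abs_def] b'_def expand_at_nth_0)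
  moreover define \<delta> where "\<delta> = norm (of_rat (poly (lead_coeff f) b) :: complex) / 2"
  moreover have \<delta>: "\<delta> > 0" using lc by (simp add: \<delta>_def)
  ultimately have lcf: "eventually (\<lambda>s. norm (lcf s) > \<delta>) sequentially"
    by (intro order_tendstoD(1)[OF tendsto_norm]) (auto simp: \<delta>_def)
  have degP: "degree (P s) = n" "lead_coeff (P s) = lcf s" if "norm (lcf s) > \<delta>" for s
  proof -
    show "degree (P s) = n"
      unfolding P_def n_def by (rule degree_complex_spec) (use that \<delta> in \<open>auto simp: lcf_def\<close>)
    thus "lead_coeff (P s) = lcf s" by (simp add: P_def coeff_complex_spec lcf_def n_def)
  qed

  \<comment> \<open>Truncating \<open>y \<alpha>\<close> after \<open>n * N\<close> terms leaves a residue of order \<open>s ^ (- n * N)\<close>, which is up to the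
    leading coefficient the product of the distances to the \<open>n\<close> roots; so the nearest one is within
    order \<open>s ^ (- N)\<close>.\<close>
  have near: "\<exists>C. eventually (\<lambda>s. \<exists>x. poly (P s) x = 0 \<and> norm (z (n * N) \<alpha> s - x) * of_nat s ^ N \<le> C) sequentially"
    if "\<alpha> \<in> R" for \<alpha> N
  proof -
    have "asym_upto (n * N) (\<lambda>s. poly (P s) (z (n * N) \<alpha> s))
        (poly (map_poly (expand_at b) f) (fps_cutoff (n * N) (y \<alpha>)))"
      unfolding P_def complex_spec_def
      by (rule asym_poly_map_poly[OF ring_map_of_rat_poly ring_map_expand_at _ z_asym])
         (simp only: b'_def asym_expand_at)
    moreover have "poly (map_poly (expand_at b) f) (fps_cutoff (n * N) (y \<alpha>)) $ k = 0" if "k < n * N" for k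
    proof -
      have "poly (map_poly (expand_at b) f) (fps_cutoff (n * N) (y \<alpha>)) $ k =
          poly (map_poly (expand_at b) f) (y \<alpha>) $ k"
        by (rule poly_fps_cong[OF _ that]) simp
      thus ?thesis using y \<open>\<alpha> \<in> R\<close> by simp
    qed
    ultimately have "(\<lambda>s. poly (P s) (z (n * N) \<alpha> s)) \<in> O(\<lambda>s. 1 / of_nat s ^ (n * N))"
      by (rule asym_vanishing_bigo)
    then obtain c where c: "eventually (\<lambda>s. norm (poly (P s) (z (n * N) \<alpha> s)) \<le>
        c * norm (1 / of_nat s ^ (n * N) :: complex)) sequentially"
      by (auto elim: landau_o.bigE)
    \<comment> \<open>Since \<open>C\<close> is at least 1, it is bounded by its own
      \<open>n\<close>-th power, which permits taking the \<open>n\<close>-th root below.\<close>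
    define C where "C = max 1 (c / \<delta>)"
    have "eventually (\<lambda>s. \<exists>x. poly (P s) x = 0 \<and> norm (z (n * N) \<alpha> s - x) * of_nat s ^ N \<le> C) sequentially"
      using c lcf eventually_gt_at_top[of 0]
    proof eventually_elim
      case (elim s)
      obtain x where x: "poly (P s) x = 0" "norm (lcf s) * norm (z (n * N) \<alpha> s - x) ^ n \<le> norm (poly (P s) (z (n * N) \<alpha> s))"
        using exists_near_root[of "P s" "z (n * N) \<alpha> s"] degP[OF elim(2)] deg by (auto simp: n_def)
      have "\<delta> * norm (z (n * N) \<alpha> s - x) ^ n \<le> norm (lcf s) * norm (z (n * N) \<alpha> s - x) ^ n"
        using elim(2) by (intro mult_right_mono) auto
      also note x(2)
      also note elim(1)
      also have "norm (1 / of_nat s ^ (n * N) :: complex) = 1 / (of_nat s ^ N) ^ n"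
        by (simp add: norm_divide norm_power power_mult mult.commute)
      finally have "(norm (z (n * N) \<alpha> s - x) * of_nat s ^ N) ^ n \<le> c / \<delta>"
        using \<delta> elim(3) by (simp add: power_mult_distrib field_simps)
      also have "\<dots> \<le> C" by (simp add: C_def)
      also have "\<dots> \<le> C ^ n" using deg by (intro self_le_power) (auto simp: C_def n_def)
      finally have "norm (z (n * N) \<alpha> s - x) * of_nat s ^ N \<le> C"
        using deg by (subst (asm) power_mono_iff) (auto simp: C_def n_def)
      with x(1) show ?case by blast
    qed
    thus ?thesis ..
  qed

  obtain e where e: "e > 0" "\<And>\<alpha> \<beta>. \<alpha> \<in> R \<Longrightarrow> \<beta> \<in> R \<Longrightarrow> \<alpha> \<noteq> \<beta> \<Longrightarrow> 2 * e \<le> dist \<alpha> \<beta>"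
    using exists_separation[OF fin] by blast
  \<comment> \<open>For positive \<open>N\<close> both the truncation and the error bound converge,
    so the nearby root ends up in the disc of radius \<open>e\<close> around
    \<open>\<alpha>\<close>.\<close>
  have close: "eventually (\<lambda>s. \<exists>x. poly (P s) x = 0 \<and> dist x \<alpha> < e \<and> norm (z (n * N) \<alpha> s - x) * of_nat s ^ N \<le> C) sequentially"
    if C: "eventually (\<lambda>s. \<exists>x. poly (P s) x = 0 \<and> norm (z (n * N) \<alpha> s - x) * of_nat s ^ N \<le> C) sequentially"
      and "\<alpha> \<in> R" "N > 0" for \<alpha> N C
  proof -
    have "n * N > 0" using deg \<open>N > 0\<close> by (simp add: n_def)
    hence "z (n * N) \<alpha> \<longlonglongrightarrow> \<alpha>"
      using asym_upto_limit[OF z_asym[of "Suc 0" "n * N" \<alpha>]] y \<open>\<alpha> \<in> R\<close> by simp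
    hence z: "eventually (\<lambda>s. dist (z (n * N) \<alpha> s) \<alpha> < e / 2) sequentially"
      using e(1) by (intro tendstoD) auto
    have "(\<lambda>s. C * (1 / real s) ^ N) \<longlonglongrightarrow> C * 0 ^ N"
      by (intro tendsto_mult tendsto_const tendsto_power lim_1_over_n)
    hence "eventually (\<lambda>s. C * (1 / real s) ^ N < e / 2) sequentially"
      using e(1) \<open>N > 0\<close> by (intro order_tendstoD(2)) (auto simp: zero_power)
    with z C eventually_gt_at_top[of 0] show ?thesis
    proof eventually_elim
      case (elim s)
      then obtain x where x: "poly (P s) x = 0" "norm (z (n * N) \<alpha> s - x) * of_nat s ^ N \<le> C" by blast
      have "norm (z (n * N) \<alpha> s - x) \<le> C * (1 / real s) ^ N"
        using x(2) elim(3) by (simp add: field_simps power_divide)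
      with elim(4) have "dist (z (n * N) \<alpha> s) x < e / 2" by (simp add: dist_norm)
      from dist_triangle_half_r[OF this elim(1)] have "dist x \<alpha> < e" .
      with x show ?case by blast
    qed
  qed

  \<comment> \<open>The choice refers to the disc only and so does not depend on \<open>N\<close>; a
    single root function then serves all orders of expansion.\<close>
  define r where "r \<alpha> s = (SOME x. poly (P s) x = 0 \<and> dist x \<alpha> < e)" for \<alpha> s
  have "eventually (\<lambda>s. \<forall>\<alpha>\<in>R. \<exists>x. poly (P s) x = 0 \<and> dist x \<alpha> < e) sequentially"
  proof (intro eventually_ball_finite fin ballI)
    fix \<alpha> assume "\<alpha> \<in> R"
    obtain C where "eventually (\<lambda>s. \<exists>x. poly (P s) x = 0 \<and> norm (z (n * 1) \<alpha> s - x) * of_nat s ^ 1 \<le> C) sequentially"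
      using near[OF \<open>\<alpha> \<in> R\<close>] by blast
    from close[OF this \<open>\<alpha> \<in> R\<close>]
    show "eventually (\<lambda>s. \<exists>x. poly (P s) x = 0 \<and> dist x \<alpha> < e) sequentially"
      by (auto elim: eventually_mono)
  qed
  hence r: "eventually (\<lambda>s. \<forall>\<alpha>\<in>R. poly (P s) (r \<alpha> s) = 0 \<and> dist (r \<alpha> s) \<alpha> < e) sequentially"
  proof eventually_elim
    case (elim s)
    show ?case
    proof
      fix \<alpha> assume "\<alpha> \<in> R"
      with elim have "\<exists>x. poly (P s) x = 0 \<and> dist x \<alpha> < e" by blast
      from someI_ex[OF this] show "poly (P s) (r \<alpha> s) = 0 \<and> dist (r \<alpha> s) \<alpha> < e"
        unfolding r_def .
    qed
  qed
  have eq: "\<alpha> = \<beta>" if "\<alpha> \<in> R" "\<beta> \<in> R" "dist x \<alpha> < e" "dist x \<beta> < e" for x \<alpha> \<beta>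
  proof (rule ccontr)
    assume "\<alpha> \<noteq> \<beta>"
    with e(2) that have "2 * e \<le> dist \<alpha> \<beta>" by blast
    moreover have "dist \<alpha> \<beta> \<le> dist x \<alpha> + dist x \<beta>" by (metis dist_commute dist_triangle)
    ultimately show False using that by linarith
  qed
  \<comment> \<open>The discs are disjoint, so the \<open>r \<alpha> s\<close> are \<open>n\<close>
    distinct roots of a polynomial of degree \<open>n\<close> and exhaust its roots.\<close>
  have roots: "eventually (\<lambda>s. inj_on (\<lambda>\<alpha>. r \<alpha> s) R \<and> (\<forall>x. poly (P s) x = 0 \<longrightarrow> x \<in> (\<lambda>\<alpha>. r \<alpha> s) ` R) \<and>
      P s = smult (lcf s) (\<Prod>\<alpha>\<in>R. [:- r \<alpha> s, 1:])) sequentially"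
    using r lcf
  proof eventually_elim
    case (elim s)
    have inj: "inj_on (\<lambda>\<alpha>. r \<alpha> s) R"
    proof (rule inj_onI)
      fix \<alpha> \<beta> assume "\<alpha> \<in> R" "\<beta> \<in> R" "r \<alpha> s = r \<beta> s"
      thus "\<alpha> = \<beta>" using eq[of \<alpha> \<beta> "r \<alpha> s"] elim(1) by metis
    qed
    have cardr: "card ((\<lambda>\<alpha>. r \<alpha> s) ` R) = n" using inj card by (simp add: card_image)
    have dP: "degree (P s) = n" "lead_coeff (P s) = lcf s" using degP elim(2) by auto
    have "P s \<noteq> 0" using dP deg by (auto simp: n_def)
    hence "(\<lambda>\<alpha>. r \<alpha> s) ` R = {x. poly (P s) x = 0}"
      using elim(1) cardr dP(1) card_poly_roots_bound[of "P s"]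
      by (intro card_seteq poly_roots_finite) auto
    moreover have "P s = smult (lcf s) (\<Prod>\<alpha>\<in>R. [:- r \<alpha> s, 1:])" (is "_ = ?Q")
    proof -
      have dQ: "degree (\<Prod>\<alpha>\<in>R. [:- r \<alpha> s, 1:]) = n"
        by (subst degree_prod_eq_sum_degree) (use card in auto)
      have lQ: "lead_coeff (\<Prod>\<alpha>\<in>R. [:- r \<alpha> s, 1:]) = 1"
        by (simp add: lead_coeff_prod)
      show ?thesis
      proof (rule poly_eqI_degree_lead_coeff[of _ n])
        show "coeff (P s) n = coeff ?Q n" using dP dQ lQ by simp
        show "degree (P s) \<le> n" using dP(1) by simp
        show "degree ?Q \<le> n"
          using degree_smult_le[of "lcf s" "\<Prod>\<alpha>\<in>R. [:- r \<alpha> s, 1:]"] unfolding dQ .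
        show "card ((\<lambda>\<alpha>. r \<alpha> s) ` R) \<ge> n" using cardr by simp
        show "poly (P s) x = poly ?Q x" if "x \<in> (\<lambda>\<alpha>. r \<alpha> s) ` R" for x
          using that elim(1) fin by (auto simp: poly_prod prod_zero_iff)
      qed
    qed
    ultimately show ?case using inj by blast
  qed

  have r_asym: "asym_upto N (r \<alpha>) (y \<alpha>)" if "\<alpha> \<in> R" "N > 0" for \<alpha> N
  proof -
    obtain C where "eventually (\<lambda>s. \<exists>x. poly (P s) x = 0 \<and> norm (z (n * N) \<alpha> s - x) * of_nat s ^ N \<le> C) sequentially"
      using near[OF \<open>\<alpha> \<in> R\<close>] by blast
    note close[OF this that]
    with r roots eventually_gt_at_top[of 0]
    have "eventually (\<lambda>s. norm (r \<alpha> s - z (n * N) \<alpha> s) \<le> C * norm (1 / of_nat s ^ N :: complex)) sequentially"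
    proof eventually_elim
      case (elim s)
      then obtain x where x: "poly (P s) x = 0" "dist x \<alpha> < e" "norm (z (n * N) \<alpha> s - x) * of_nat s ^ N \<le> C" by blast
      with elim(2) obtain \<beta> where \<beta>: "\<beta> \<in> R" "x = r \<beta> s" by blast
      \<comment> \<open>The root close to the truncation is some \<open>r \<beta> s\<close> and lies
        in the discs of both \<open>\<alpha>\<close> and \<open>\<beta>\<close>; hence it is
        \<open>r \<alpha> s\<close>.\<close>
      hence "\<beta> = \<alpha>" using eq[of \<beta> \<alpha> x] elim(1) x(2) that(1) by blast
      thus ?case using x(3) \<beta> elim(3) by (simp add: norm_divide norm_power norm_minus_commute field_simps)
    qed
    hence "(\<lambda>s. r \<alpha> s - z (n * N) \<alpha> s) \<in> O(\<lambda>s. 1 / of_nat s ^ N)" by (rule bigoI)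
    moreover have "asym_upto N (z (n * N) \<alpha>) (y \<alpha>)"
    proof -
      have "N \<le> n * N" using deg by (simp add: n_def)
      hence "k < n * N" if "k < N" for k using that by (rule less_le_trans[rotated])
      hence "asym_upto N (z (n * N) \<alpha>) (y \<alpha>) \<longleftrightarrow> asym_upto N (z (n * N) \<alpha>) (fps_cutoff (n * N) (y \<alpha>))"
        by (intro asym_upto_cong) auto
      thus ?thesis using z_asym by blast
    qed
    ultimately have "(\<lambda>s. (r \<alpha> s - z (n * N) \<alpha> s) + (z (n * N) \<alpha> s - (\<Sum>k<N. y \<alpha> $ k / of_nat s ^ k)))
        \<in> O(\<lambda>s. 1 / of_nat s ^ N)"
      unfolding asym_upto_def by (rule sum_in_bigo)
    thus ?thesis by (simp add: asym_upto_def)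
  qed
  show ?thesis
  proof (rule that[of y r])
    \<comment> \<open>\<open>r_asym\<close> covers positive orders only; descending from
      \<open>Suc N\<close> includes order 0.\<close>
    show "asym_upto N (r \<alpha>) (y \<alpha>)" if "\<alpha> \<in> R" for \<alpha> N
      using asym_upto_antimono[OF r_asym[OF that, of "Suc N"], of N] by simp
    show "poly (map_poly (expand_at b) f) (y \<alpha>) = 0" if "\<alpha> \<in> R" for \<alpha> using y that by blast
    show "eventually (\<lambda>s. poly (lead_coeff f) (b' s) \<noteq> 0 \<and> inj_on (\<lambda>\<alpha>. r \<alpha> s) R \<and>
       complex_spec f (b' s) = smult (of_rat (poly (lead_coeff f) (b' s))) (\<Prod>\<alpha>\<in>R. [:- r \<alpha> s, 1:])) sequentially"
      using roots lcf by eventually_elim (use \<delta> in \<open>auto simp: P_def lcf_def\<close>)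
  qed
qed

section \<open>Reducible specializations\<close>

lemma specialization_common_denominator:
  fixes f :: "rat poly poly" and b :: rat
  obtains M :: int and K :: nat where "M \<noteq> 0"
    "\<And>s j. s > 0 \<Longrightarrow> of_int M * of_nat s ^ K * poly (coeff f j) (b + 1 / of_nat s) \<in> \<int>"
proof -
  define good where "good M K q \<longleftrightarrow> (\<forall>s>0. of_int M * of_nat s ^ K * poly q (b + 1 / of_nat s) \<in> \<int>)"
    for M :: int and K :: nat and q :: "rat poly"
  have mono: "good (M * M') (K + K') q" if "good M K q" for M M' K K' q
    unfolding good_def
  proof (intro allI impI)
    fix s :: nat assume "s > 0"
    hence "of_int M' * of_nat s ^ K' * (of_int M * of_nat s ^ K * poly q (b + 1 / of_nat s)) \<in> \<int>"
      by (intro Ints_mult[OF Ints_mult[OF Ints_of_int Ints_power[OF Ints_of_nat]]] that[unfolded good_def, rule_format])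
    thus "of_int (M * M') * of_nat s ^ (K + K') * poly q (b + 1 / of_nat s) \<in> \<int>"
      by (simp add: power_add mult_ac)
  qed
  obtain c d where cd: "d > 0" "b = of_int c / of_int d"
    using quotient_of_denom_pos quotient_of_div by (metis surj_pair)
  have single: "\<exists>M K. M \<noteq> 0 \<and> good M K q" for q
  proof (induction q)
    case 0
    show ?case by (intro exI[of _ 1] exI[of _ 0]) (simp add: good_def)
  next
    case (pCons a q)
    then obtain M K where MK: "M \<noteq> 0" "good M K q" by blast
    obtain m k where mk: "k > 0" "a = of_int m / of_int k"
      using quotient_of_denom_pos quotient_of_div by (metis surj_pair)
    \<comment> \<open>A Horner step multiplies by b + 1/s = (cs + d)/(ds), which costs a factor
      \<open>d\<close> and one power of \<open>s\<close>; \<open>k\<close> is the denominator of the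
      new coefficient.\<close>
    have "good (M * k * d) (Suc K) (pCons a q)"
      unfolding good_def
    proof (intro allI impI)
      fix s :: nat assume s: "s > 0"
      define i where "i = of_int M * of_nat s ^ K * poly q (b + 1 / of_nat s)"
      have "i \<in> \<int>" using MK(2) s by (simp add: good_def i_def)
      hence "of_int (M * m * d) * of_nat s ^ Suc K + of_int k * (of_int c * of_nat s + of_int d) * i \<in> \<int>"
        by (intro Ints_add Ints_mult Ints_power Ints_of_int Ints_of_nat)
      also have "of_int (M * m * d) * of_nat s ^ Suc K + of_int k * (of_int c * of_nat s + of_int d) * i =
          of_int (M * k * d) * of_nat s ^ Suc K * poly (pCons a q) (b + 1 / of_nat s)"
      proof -
        have 1: "of_int m = a * of_int k" using mk by simp
        have 2: "of_int c * of_nat s + of_int d = of_int d * of_nat s * (b + 1 / of_nat s)"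
        proof -
          have "of_int c = of_int d * b" using cd by simp
          thus ?thesis using s by (simp add: algebra_simps)
        qed
        show ?thesis unfolding i_def of_int_mult 1 2 by (simp add: algebra_simps)
      qed
      finally show "of_int (M * k * d) * of_nat s ^ Suc K * poly (pCons a q) (b + 1 / of_nat s) \<in> \<int>" .
    qed
    thus ?case using MK(1) mk(1) cd(1) by (intro exI[of _ "M * k * d"] exI[of _ "Suc K"]) auto
  qed
  have "\<exists>M K. M \<noteq> 0 \<and> (\<forall>j. good M K (coeff f j))"
  proof (induction f)
    case 0
    show ?case by (intro exI[of _ 1] exI[of _ 0]) (simp add: good_def)
  next
    case (pCons q f)
    obtain M K M' K' where 1: "M \<noteq> 0" "\<forall>j. good M K (coeff f j)" and 2: "M' \<noteq> 0" "good M' K' q"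
      using pCons.IH single[of q] by blast
    have "good (M * M') (K + K') (coeff (pCons q f) j)" for j
      using mono[of M K _ M' K'] mono[of M' K' _ M K] 1 2
      by (cases j) (simp_all add: mult.commute add.commute)
    thus ?case using 1 2 by (intro exI[of _ "M * M'"] exI[of _ "K + K'"]) auto
  qed
  thus ?thesis using that unfolding good_def by blast
qed

lemma map_poly_of_rat_specialize:
  "map_poly of_rat (specialize_X f b) = complex_spec f b"
  by (rule poly_eqI) (simp add: specialize_X_def coeff_complex_spec coeff_map_poly)

text \<open>No factor has more roots than its degree, and every \<open>r \<alpha>\<close> is a root of one of the two factors,
  so by counting each factor splits over its share of the \<open>r \<alpha>\<close>; Gauss' lemma gives integrality.\<close>

lemma reducible_specialization:
  fixes f :: "rat poly poly"
  assumes red: "\<not> irreducible (specialize_X f b)" and deg: "degree f > 0"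
    and lc: "poly (lead_coeff f) b \<noteq> 0"
    and R: "finite R" "inj_on r R"
    and split: "complex_spec f b = smult (of_rat (poly (lead_coeff f) b)) (\<Prod>\<alpha>\<in>R. [:- r \<alpha>, 1:])"
    and int: "\<And>j. m * poly (coeff f j) b \<in> \<int>" and m: "m \<noteq> 0"
  obtains S where "S \<subseteq> R" "S \<noteq> {}" "card S < degree f"
    "\<And>j. of_rat (m * poly (lead_coeff f) b) * coeff (\<Prod>\<alpha>\<in>S. [:- r \<alpha>, 1:]) j \<in> \<int>"
proof -
  define F where "F = specialize_X f b"
  have cF: "coeff F j = poly (coeff f j) b" for j
    by (simp add: F_def specialize_X_def coeff_map_poly)
  have dF: "degree F = degree f"
  proof (rule antisym)
    show "degree F \<le> degree f" by (rule degree_le) (auto simp: cF coeff_eq_0)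
    show "degree f \<le> degree F" by (rule le_degree) (use lc in \<open>simp add: cF\<close>)
  qed
  have F0: "F \<noteq> 0" using dF deg by auto
  have "\<not> is_unit F" using dF deg F0 by (simp add: is_unit_iff_degree)
  with red F0 obtain g0 h0 where gh0: "F = g0 * h0" "\<not> is_unit g0" "\<not> is_unit h0"
    unfolding irreducible_def F_def by blast
  have nz: "g0 \<noteq> 0" "h0 \<noteq> 0" using gh0 F0 by auto
  \<comment> \<open>Shifting the leading coefficient into the other factor makes \<open>g\<close>
    monic, as Gauss's lemma and the product of linear factors require.\<close>
  define g where "g = smult (inverse (lead_coeff g0)) g0"
  define h where "h = smult (lead_coeff g0) h0"
  have gh: "F = g * h" using gh0 nz by (simp add: g_def h_def)
  have dg: "degree g > 0" "degree h > 0"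
    using gh0 nz by (simp_all add: g_def h_def is_unit_iff_degree)
  have g0h0: "g \<noteq> 0" "h \<noteq> 0" using dg by auto
  have dgh: "degree g + degree h = degree f" using gh dF g0h0 by (simp add: degree_mult_eq)
  have lg: "lead_coeff g = 1" using nz by (simp add: g_def)

  interpret q: ring_map "of_rat :: rat \<Rightarrow> complex" by (rule ring_map_of_rat)
  define gc where "gc = map_poly (of_rat :: rat \<Rightarrow> complex) g"
  define hc where "hc = map_poly (of_rat :: rat \<Rightarrow> complex) h"
  have dc: "degree gc = degree g" "degree hc = degree h"
    unfolding gc_def hc_def by (rule degree_map_poly; simp)+
  have c0: "gc \<noteq> 0" "hc \<noteq> 0" using dc dg by auto
  have prod: "gc * hc = complex_spec f b"
    unfolding gc_def hc_def q.map_poly_mult[symmetric] gh[symmetric] F_def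
    by (rule map_poly_of_rat_specialize)
  define S where "S = {\<alpha>\<in>R. poly gc (r \<alpha>) = 0}"
  define T where "T = {\<alpha>\<in>R. poly hc (r \<alpha>) = 0}"
  have ST: "S \<subseteq> R" "T \<subseteq> R" "finite S" "finite T" using R(1) by (auto simp: S_def T_def)
  have RST: "R = S \<union> T"
  proof -
    have "poly gc (r \<alpha>) = 0 \<or> poly hc (r \<alpha>) = 0" if "\<alpha> \<in> R" for \<alpha>
    proof -
      have "poly (gc * hc) (r \<alpha>) = 0" unfolding prod split using R(1) that by (auto simp: poly_prod prod_zero_iff)
      thus ?thesis by simp
    qed
    thus ?thesis by (auto simp: S_def T_def)
  qed
  have cR: "card R = degree f"
  proof -
    have "degree (complex_spec f b) = degree (\<Prod>\<alpha>\<in>R. [:- r \<alpha>, 1:])" unfolding split using lc by simp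
    also have "\<dots> = card R" by (subst degree_prod_eq_sum_degree) auto
    finally show ?thesis using degree_complex_spec[OF lc] by simp
  qed
  have cS: "card S \<le> degree g" "card T \<le> degree h"
  proof -
    have "card (r ` S) \<le> card {x. poly gc x = 0}"
      by (intro card_mono poly_roots_finite c0) (auto simp: S_def)
    also have "\<dots> \<le> degree gc" by (rule card_poly_roots_bound[OF c0(1)])
    finally show "card S \<le> degree g" using inj_on_subset[OF R(2) ST(1)] by (simp add: card_image dc)
    have "card (r ` T) \<le> card {x. poly hc x = 0}"
      by (intro card_mono poly_roots_finite c0) (auto simp: T_def)
    also have "\<dots> \<le> degree hc" by (rule card_poly_roots_bound[OF c0(2)])
    finally show "card T \<le> degree h" using inj_on_subset[OF R(2) ST(2)] by (simp add: card_image dc)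
  qed
  have "card R \<le> card S + card T" unfolding RST by (rule card_Un_le)
  hence cSg: "card S = degree g" using cS dgh cR by linarith
  have gcS: "gc = (\<Prod>\<alpha>\<in>S. [:- r \<alpha>, 1:])"
  proof -
    have dQ: "degree (\<Prod>\<alpha>\<in>S. [:- r \<alpha>, 1:]) = degree g"
      by (subst degree_prod_eq_sum_degree) (use cSg in auto)
    have lQ: "lead_coeff (\<Prod>\<alpha>\<in>S. [:- r \<alpha>, 1:]) = 1"
      by (simp add: lead_coeff_prod)
    show ?thesis
    proof (rule poly_eqI_degree_lead_coeff[of _ "degree g"])
      show "coeff gc (degree g) = coeff (\<Prod>\<alpha>\<in>S. [:- r \<alpha>, 1:]) (degree g)"
        using lQ lg dQ by (simp add: gc_def coeff_map_poly)
      show "degree gc \<le> degree g" "degree (\<Prod>\<alpha>\<in>S. [:- r \<alpha>, 1:]) \<le> degree g" using dc dQ by auto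
      show "card (r ` S) \<ge> degree g" using inj_on_subset[OF R(2) ST(1)] cSg by (simp add: card_image)
      show "poly gc x = poly (\<Prod>\<alpha>\<in>S. [:- r \<alpha>, 1:]) x" if "x \<in> r ` S" for x
        using that ST(3) by (auto simp: poly_prod prod_zero_iff S_def)
    qed
  qed

  \<comment> \<open>All coefficients of \<open>smult m F\<close> are integral, so
    \<open>floor\<close> merely changes their type.\<close>
  define G where "G = map_poly floor (smult m F)"
  have G: "map_poly of_int G = smult m F"
  proof (rule poly_eqI)
    fix j
    have "m * coeff F j \<in> \<int>" using int by (simp add: cF)
    then obtain k :: int where "m * coeff F j = of_int k" by (auto elim: Ints_cases)
    thus "coeff (map_poly of_int G) j = coeff (smult m F) j"
      by (simp add: G_def coeff_map_poly)
  qed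
  have "degree (map_poly (of_int :: int \<Rightarrow> rat) G) = degree G" by (rule degree_map_poly) auto
  hence "degree G = degree f" using m dF by (simp add: G)
  hence lG: "of_int (lead_coeff G) = m * poly (lead_coeff f) b"
    using arg_cong[OF G, of "\<lambda>p. coeff p (degree f)"] by (simp add: coeff_map_poly cF)
  have "g dvd map_poly of_int G" unfolding G gh by (simp add: dvd_smult)
  from lead_coeff_mult_monic_divisor_integral[OF lg this]
  have gint: "m * poly (lead_coeff f) b * coeff g j \<in> \<int>" for j unfolding lG .
  show ?thesis
  proof (rule that[of S])
    show "S \<subseteq> R" by (rule ST)
    show "S \<noteq> {}" using cSg dg by auto
    show "card S < degree f" using cSg dgh dg by linarith
    fix j
    obtain k :: int where "m * poly (lead_coeff f) b * coeff g j = of_int k" using gint by (auto elim: Ints_cases)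
    hence "of_rat (m * poly (lead_coeff f) b * coeff g j) = (of_int k :: complex)" by simp
    thus "of_rat (m * poly (lead_coeff f) b) * coeff (\<Prod>\<alpha>\<in>S. [:- r \<alpha>, 1:]) j \<in> \<int>"
      unfolding gcS[symmetric] gc_def by (simp add: coeff_map_poly of_rat_mult)
  qed
qed

text \<open>Applying \<open>\<theta>\<close> to the Bezout identity and evaluating at a common root
  \<open>y\<close> would give \<open>\<theta> R = 0\<close>, against injectivity.\<close>

lemma irreducible_no_small_common_root:
  fixes f h :: "rat poly poly"
  assumes "irreducible f" "h \<noteq> 0" "degree h < degree f" and \<theta>: "ring_map \<theta>" "\<And>p. \<theta> p = 0 \<Longrightarrow> p = 0"
    and "poly (map_poly \<theta> f) y = 0"
  shows "poly (map_poly \<theta> h) y \<noteq> 0"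
proof
  assume "poly (map_poly \<theta> h) y = 0"
  obtain A B R where ABR: "R \<noteq> 0" "A * f + B * h = [:R:]"
    by (rule irreducible_bezout[OF assms(1-3)])
  interpret ring_map \<theta> by (rule \<theta>)
  have "\<theta> R = poly (map_poly \<theta> [:R:]) y" by (simp add: map_poly_pCons)
  also have "\<dots> = 0" unfolding ABR(2)[symmetric] map_poly_add map_poly_mult
    using assms(6) \<open>poly (map_poly \<theta> h) y = 0\<close> by simp
  finally show False using \<theta>(2) ABR(1) by blast
qed

text \<open>The Bezout constant \<open>R\<close> of \<open>f\<close> and its derivative in Y plays
  the part of a discriminant: where it does not vanish, the specialization shares no root with its
  derivative.\<close>

lemma squarefree_specialization:
  fixes f :: "rat poly poly"
  assumes "irreducible f" "degree f > 0"
  obtains b where "poly (lead_coeff f) b \<noteq> 0" "rsquarefree (complex_spec f b)"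
proof -
  have "pderiv f \<noteq> 0" using assms(2) by (simp add: pderiv_eq_0_iff)
  moreover have "degree (pderiv f) < degree f" using assms(2) by (simp add: degree_pderiv)
  ultimately obtain A B R where ABR: "R \<noteq> 0" "A * f + B * pderiv f = [:R:]"
    using irreducible_bezout[OF assms(1)] by blast
  have "lead_coeff f * R \<noteq> 0" using ABR(1) assms(2) by auto
  hence "finite {b. poly (lead_coeff f * R) b = 0}" by (rule poly_roots_finite)
  from ex_new_if_finite[OF infinite_UNIV_char_0 this]
  obtain b where b: "poly (lead_coeff f * R) b \<noteq> 0" by auto
  interpret ring_map "\<lambda>q. of_rat (poly q b) :: complex" by (rule ring_map_of_rat_poly)
  have "rsquarefree (complex_spec f b)"
    unfolding rsquarefree_roots
  proof (intro allI notI)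
    fix x assume x: "poly (complex_spec f b) x = 0 \<and> poly (pderiv (complex_spec f b)) x = 0"
    have "complex_of_rat (poly R b) = poly (map_poly (\<lambda>q. of_rat (poly q b)) [:R:]) x"
      by (simp add: map_poly_pCons)
    also have "\<dots> = 0" unfolding ABR(2)[symmetric] map_poly_add map_poly_mult map_poly_pderiv
      using x by (simp add: complex_spec_def)
    finally show False using b by simp
  qed
  with b show ?thesis by (intro that) auto
qed

section \<open>Covering the natural numbers by thin sets\<close>

theorem theorem7:
  fixes f :: "rat poly poly"
  assumes "irreducible_XY f"
  shows "infinite {b :: rat. irreducible (specialize_X f b)}"
proof
  assume fin: "finite {b :: rat. irreducible (specialize_X f b)}"
  have irr: "irreducible f" and deg: "degree f > 0" using assms by (auto simp: irreducible_XY_def)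
  obtain b where lc: "poly (lead_coeff f) b \<noteq> 0" and sqf: "rsquarefree (complex_spec f b)"
    by (rule squarefree_specialization[OF irr deg])
  define R where "R = {x. poly (complex_spec f b) x = 0}"
  have "complex_spec f b \<noteq> 0" using degree_complex_spec[OF lc] deg by auto
  hence finR: "finite R" unfolding R_def by (rule poly_roots_finite)
  define b' where "b' s = b + 1 / of_nat s" for s :: nat
  obtain y r where
    y: "\<And>\<alpha>. \<alpha> \<in> R \<Longrightarrow> poly (map_poly (expand_at b) f) (y \<alpha>) = 0" and
    r: "\<And>\<alpha> N. \<alpha> \<in> R \<Longrightarrow> asym_upto N (r \<alpha>) (y \<alpha>)" and
    ev: "eventually (\<lambda>s. poly (lead_coeff f) (b' s) \<noteq> 0 \<and> inj_on (\<lambda>\<alpha>. r \<alpha> s) R \<and>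
       complex_spec f (b' s) = smult (of_rat (poly (lead_coeff f) (b' s))) (\<Prod>\<alpha>\<in>R. [:- r \<alpha> s, 1:])) sequentially"
    using root_expansions[OF deg lc sqf] unfolding R_def b'_def by blast
  obtain M :: int and K :: nat where M: "M \<noteq> 0" and
    MK: "\<And>s j. s > 0 \<Longrightarrow> of_int M * of_nat s ^ K * poly (coeff f j) (b' s) \<in> \<int>"
    unfolding b'_def by (rule specialization_common_denominator[of f b]) blast

  define u where "u S j s = of_int M * of_rat (poly (lead_coeff f) (b' s)) * coeff (\<Prod>\<alpha>\<in>S. [:- r \<alpha> s, 1:]) j"
    for S j s
  define c where "c = fps_const (of_int M) * expand_at b (lead_coeff f)"
  define \<psi> where "\<psi> S j = c * coeff (\<Prod>\<alpha>\<in>S. [:- y \<alpha>, 1:]) j" for S j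
  define \<S> where "\<S> = {S. S \<subseteq> R \<and> S \<noteq> {} \<and> card S < degree f}"
  have u: "asym_upto N (u S j) (\<psi> S j)" if "S \<in> \<S>" for N S j
  proof -
    have "asym_upto N (\<lambda>s. coeff (\<Prod>\<alpha>\<in>S. [:- r \<alpha> s, 1:]) j) (coeff (\<Prod>\<alpha>\<in>S. [:- y \<alpha>, 1:]) j)"
      by (rule asym_coeff_prod_linear) (use that finR r in \<open>auto simp: \<S>_def intro: finite_subset\<close>)
    thus ?thesis unfolding u_def \<psi>_def c_def b'_def
      by (intro asym_upto_mult asym_upto_cmult asym_expand_at)
  qed

  \<comment> \<open>If no index \<open>j\<close> worked, every \<open>\<psi> S j\<close> would be a
    rational polynomial of degree at most \<open>K\<close>. Together they would form a polynomial
    over the rationals of smaller degree in Y than \<open>f\<close>, sharing a root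
    \<open>y \<alpha>\<close> with \<open>f\<close>.\<close>
  have thin: "\<exists>j. thin {s. of_nat s ^ K * u S j s \<in> \<int>}" if S: "S \<in> \<S>" for S
  proof (rule ccontr)
    assume neg: "\<not> ?thesis"
    have rat: "\<psi> S j $ k \<in> \<rat>" and zero: "k > K \<Longrightarrow> \<psi> S j $ k = 0" for j k
    proof -
      have *: "\<not> ((\<exists>k\<le>K. \<psi> S j $ k \<notin> \<rat>) \<or> (\<exists>k>K. \<psi> S j $ k \<noteq> 0))"
        using thin_Ints_asym[OF u[OF S]] neg by blast
      show "\<psi> S j $ k \<in> \<rat>" using * by (cases "k \<le> K") auto
      show "k > K \<Longrightarrow> \<psi> S j $ k = 0" using * by blast
    qed
    have "\<exists>q. \<psi> S j = fps_of_poly (map_poly of_rat q)" for j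
    proof -
      define a where "a k = (SOME a. \<psi> S j $ k = of_rat a)" for k
      have a: "\<psi> S j $ k = of_rat (a k)" for k
        unfolding a_def by (rule someI_ex) (use rat[of j k] in \<open>auto elim: Rats_cases\<close>)
      have "\<psi> S j = fps_of_poly (map_poly of_rat (\<Sum>k\<le>K. monom (a k) k))"
        by (rule fps_ext) (auto simp: coeff_map_poly coeff_sum a[symmetric] zero)
      thus ?thesis ..
    qed
    then obtain q where q: "\<And>j. \<psi> S j = fps_of_poly (map_poly of_rat (q j))" by metis
    define n where "n = card S"
    \<comment> \<open>Composition with X - b undoes the Taylor shift, so \<open>expand_at b\<close>
      maps \<open>h\<close> to \<open>smult c Q\<close>.\<close>
    define h where "h = (\<Sum>j\<le>n. monom (pcompose (q j) [:-b, 1:]) j)"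
    define Q where "Q = (\<Prod>\<alpha>\<in>S. [:- y \<alpha>, 1:])"
    have dQ: "degree Q = n" unfolding Q_def n_def by (subst degree_prod_eq_sum_degree) auto
    have lQ: "lead_coeff Q = 1" unfolding Q_def by (simp add: lead_coeff_prod)
    have hQ: "map_poly (expand_at b) h = smult c Q"
    proof (rule poly_eqI)
      fix j
      have "coeff (map_poly (expand_at b) h) j = (if j \<le> n then \<psi> S j else 0)"
        by (simp add: coeff_map_poly_ring_map[OF ring_map_expand_at] h_def coeff_sum
            expand_at_pcompose q ring_map.map_zero[OF ring_map_expand_at])
      also have "\<dots> = coeff (smult c Q) j" using dQ by (simp add: \<psi>_def Q_def coeff_eq_0)
      finally show "coeff (map_poly (expand_at b) h) j = coeff (smult c Q) j" .
    qed
    have "lead_coeff f \<noteq> 0" using deg by auto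
    hence c0: "c \<noteq> 0" using M by (simp add: c_def expand_at_eq_0_iff)
    have "h \<noteq> 0" using hQ c0 lQ by auto
    moreover have "degree h < degree f"
    proof -
      have "degree h \<le> n" by (rule degree_le) (simp add: h_def coeff_sum)
      thus ?thesis using S by (simp add: n_def \<S>_def)
    qed
    moreover obtain \<alpha> where \<alpha>: "\<alpha> \<in> S" using S by (auto simp: \<S>_def)
    moreover have "\<alpha> \<in> R" using \<alpha> S by (auto simp: \<S>_def)
    ultimately have "poly (map_poly (expand_at b) h) (y \<alpha>) \<noteq> 0"
      by (intro irreducible_no_small_common_root[OF irr _ _ ring_map_expand_at _ y])
         (auto simp: expand_at_eq_0_iff)
    moreover have "finite S" using S finR by (auto simp: \<S>_def intro: finite_subset)
    ultimately show False using \<alpha> by (auto simp: hQ Q_def poly_prod prod_zero_iff)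
  qed
  then obtain J where J: "\<And>S. S \<in> \<S> \<Longrightarrow> thin {s. of_nat s ^ K * u S (J S) s \<in> \<int>}" by metis

  from ev obtain s0 where s0: "\<And>s. s \<ge> s0 \<Longrightarrow> poly (lead_coeff f) (b' s) \<noteq> 0 \<and> inj_on (\<lambda>\<alpha>. r \<alpha> s) R \<and>
       complex_spec f (b' s) = smult (of_rat (poly (lead_coeff f) (b' s))) (\<Prod>\<alpha>\<in>R. [:- r \<alpha> s, 1:])"
    by (auto simp: eventually_sequentially)
  define I where "I = {s. s > 0 \<and> irreducible (specialize_X f (b' s))}"
  \<comment> \<open>Distinct positive \<open>s\<close> give distinct points \<open>b' s\<close>, so
    the assumed finiteness of good points bounds \<open>I\<close>.\<close>
  have "finite I"
  proof (rule finite_imageD)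
    show "finite (b' ` I)" by (rule finite_subset[OF _ fin]) (auto simp: I_def)
    show "inj_on b' I" by (auto simp: inj_on_def b'_def I_def)
  qed
  \<comment> \<open>A reducible specialization yields some \<open>S\<close> for which all scaled
    coefficients are integral, in particular the one with index \<open>J S\<close> that was selected
    for its thin set.\<close>
  have cover: "s \<in> (\<Union>S\<in>\<S>. {s. of_nat s ^ K * u S (J S) s \<in> \<int>})"
    if s: "s \<notin> I" "s > 0" "s \<ge> s0" for s
  proof -
    have m: "of_int M * of_nat s ^ K \<noteq> (0 :: rat)" using M s by simp
    have red: "\<not> irreducible (specialize_X f (b' s))" using s by (simp add: I_def)
    from s0[OF s(3)] obtain S where S: "S \<subseteq> R" "S \<noteq> {}" "card S < degree f"
      "\<And>j. of_rat (of_int M * of_nat s ^ K * poly (lead_coeff f) (b' s)) * coeff (\<Prod>\<alpha>\<in>S. [:- r \<alpha> s, 1:]) j \<in> \<int>"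
      using reducible_specialization[OF red deg _ finR _ _ MK[OF s(2)] m] by blast
    have "of_nat s ^ K * u S (J S) s \<in> \<int>"
      using S(4)[of "J S"] by (simp add: u_def of_rat_mult of_rat_power mult_ac)
    thus ?thesis using S by (auto simp: \<S>_def)
  qed
  have "finite \<S>" unfolding \<S>_def by (rule finite_subset[of _ "Pow R"]) (use finR in auto)
  hence "thin (\<Union>S\<in>\<S>. {s. of_nat s ^ K * u S (J S) s \<in> \<int>})" by (rule thin_UN) (rule J)
  moreover have "thin (I \<union> {..s0})" using \<open>finite I\<close> by (intro thin_finite) auto
  ultimately have "thin ((I \<union> {..s0}) \<union> (\<Union>S\<in>\<S>. {s. of_nat s ^ K * u S (J S) s \<in> \<int>}))"
    by (rule thin_Un[rotated])
  moreover have "UNIV \<subseteq> (I \<union> {..s0}) \<union> (\<Union>S\<in>\<S>. {s. of_nat s ^ K * u S (J S) s \<in> \<int>})"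
  proof
    fix s
    show "s \<in> (I \<union> {..s0}) \<union> (\<Union>S\<in>\<S>. {s. of_nat s ^ K * u S (J S) s \<in> \<int>})"
    proof (cases "s \<in> I \<or> s \<le> s0")
      case False
      with cover[of s] show ?thesis by auto
    qed auto
  qed
  ultimately have "thin UNIV" by (rule thin_subset)
  thus False using not_thin_UNIV by blast
qed

end
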